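(* For every $n$, the map $I_n:\mathcal{K}\to\mathcal{P}_n$ defines a universal invariant of degree $n$ of virtual knots. That is, $I_n$ is an invariant of degree at most $n$, and for every abelian group $G$ and every invariant $\nu:\mathcal{K}\to G$ of degree at most $n$ there exists a group homomorphism $\pi:\mathcal{P}_n\to G$ such that $\nu=\pi\circ I_n$.
   Context: A Gauss diagram is an oriented circle with a finite set of arrows, i.e. ordered pairs (tail, head) of points of the circle, all endpoints being pairwise distinct, each arrow being equipped with a sign $\pm$; Gauss diagrams are considered up to orientation preserving homeomorphism of the circle. Let $\mathcal{D}$ be the set of Gauss diagrams. A virtual knot is presented by a Gauss diagram (each arrow corresponds to a real crossing, is directed from the upper to the lower branch, and its sign is the local writhe; virtual crossings are disregarded), and the set $\mathcal{K}$ of virtual knots is the set of equivalence classes of Gauss diagrams under the following moves, counterparts of the Reidemeister moves, and their inverses. Two endpoints are called adjacent if one of the two arcs of the circle between them contains no other endpoints in its interior. (R1) Remove an arrow of any sign whose head and tail are adjacent. (R2) Remove two arrows of opposite signs whose tails are adjacent to each other and whose heads are adjacent to each other. (R3) Suppose there are three pairwise disjoint oriented arcs $e_1,e_2,e_3$ of the circle (in any cyclic order, oriented by the circle) and three positive arrows $a_{12},a_{13},a_{23}$, with $a_{ij}$ having its tail on $e_i$ and head on $e_j$, such that the arcs contain no other endpoints and the order of endpoints along the arcs is: on $e_1$, $a_{12}$ then $a_{13}$; on $e_2$, $a_{12}$ then $a_{23}$; on $e_3$, $a_{13}$ then $a_{23}$. Replace this by the diagram with the same arrows in which the order of the two endpoints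 is reversed on each of $e_1,e_2,e_3$. Degree. Turning a real crossing into a virtual one amounts to erasing an arrow of the Gauss diagram. For a Gauss diagram $D$ with $m$ chosen arrows $d_1,\dots,d_m$ and $\sigma\in\{0,1\}^m$, let $D_\sigma$ be obtained from $D$ by erasing each $d_i$ with $\sigma_i=1$, and let $|\sigma|$ be the number of ones in $\sigma$. The sum $\sum_\sigma(-1)^{|\sigma|}D_\sigma$ is called a diagram with $m$ semi-virtual crossings. An invariant $\nu:\mathcal{K}\to G$ with values in an abelian group, extended linearly to $\mathbb{Z}[\mathcal{K}]$, has degree at most $n$ if it vanishes on every diagram with more than $n$ semi-virtual crossings. An arrow diagram is an oriented circle with finitely many signed (dashed) arrows, i.e. the same combinatorial object as a Gauss diagram; $\mathcal{A}$ is the free abelian group generated by arrow diagrams, and $i:\mathbb{Z}[\mathcal{D}]\to\mathcal{A}$ is the isomorphism making all arrows dashed. A subdiagram $D'\subset D$ is obtained by keeping a subset of the arrows of $D$. Define $I:\mathbb{Z}[\mathcal{D}]\to\mathcal{A}$ by linearity and $I(D)=\sum_{D'\subset D}i(D')$. The Polyak algebra $\mathcal{P}$ is the quotient of $\mathcal{A}$ by the following relations. (1) $A=0$ if $A$ contains an arrow whose head and tail are adjacent. (2) $A+A_1+A_2=0$ if $A$ contains two arrows $\alpha_1,\alpha_2$ of opposite signs with adjacent tails and adjacent heads, where $A_j$ is obtained from $A$ by deleting the arrow other than $\alpha_j$. (3) If $A$ and $A'$ are the two diagrams (before and after) of a move (R3), then $\sum_{S}A_S=\sum_{S}A'_S$,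 where $S$ runs over the subsets of $\{a_{12},a_{13},a_{23}\}$ with at least two elements and $A_S$, $A'_S$ are obtained from $A$, $A'$ by deleting those of the three arrows which are not in $S$. The truncated algebra $\mathcal{P}_n$ is the quotient of $\mathcal{P}$ obtained by putting $A=0$ for every arrow diagram $A$ with more than $n$ arrows. The map $I_n:\mathcal{K}\to\mathcal{P}_n$ sends a virtual knot $K$ to the class of $I(D)$ in $\mathcal{P}_n$, where $D$ is any Gauss diagram of $K$; the class of $I(D)$ in $\mathcal{P}$, and hence in $\mathcal{P}_n$, does not depend on the choice of $D$. *)

theory Defs
  imports "HOL-Analysis.Analysis" "HOL-Algebra.Free_Abelian_Groups"
begin

section \<open>Gauss diagrams\<close>

text \<open>
  The oriented circle is the unit circle of the complex plane with its counterclockwise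
  orientation. A finite set of arrows on it is a concrete diagram; Gauss diagrams are concrete
  diagrams modulo orientation preserving homeomorphisms of the circle.
\<close>

abbreviation circle :: "complex set" where
  "circle \<equiv> sphere 0 1"

datatype sign = Pos | Neg

datatype 'p arrow = Arrow (tail: 'p) (head: 'p) (arrow_sign: sign)

definition arrow_ends :: "'p arrow \<Rightarrow> 'p set" where
  "arrow_ends a = {tail a, head a}"

definition endpoints :: "'p arrow set \<Rightarrow> 'p set" where
  "endpoints X = (\<Union>a\<in>X. arrow_ends a)"

definition diagram_on_circle :: "complex arrow set \<Rightarrow> bool" where
  "diagram_on_circle X \<longleftrightarrow>
     finite X \<and> endpoints X \<subseteq> circle \<and> (\<forall>a\<in>X. tail a \<noteq> head a) \<and>
     (\<forall>a\<in>X. \<forall>b\<in>X. a \<noteq> b \<longrightarrow> arrow_ends a \<inter> arrow_ends b = {})"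

text \<open>
  A homeomorphism of the circle preserves the orientation iff it lifts to an increasing map of
  the line along the covering \<open>cis\<close>.
\<close>

definition orientation_preserving_homeo :: "(complex \<Rightarrow> complex) \<Rightarrow> bool" where
  "orientation_preserving_homeo h \<longleftrightarrow>
     (\<exists>k. homeomorphism circle circle h k) \<and>
     (\<exists>f :: real \<Rightarrow> real. continuous_on UNIV f \<and> strict_mono f \<and> (\<forall>t. h (cis t) = cis (f t)))"

definition diagram_equiv :: "complex arrow set \<Rightarrow> complex arrow set \<Rightarrow> bool" where
  "diagram_equiv X Y \<longleftrightarrow>
     diagram_on_circle X \<and> diagram_on_circle Y \<and>
     (\<exists>h. orientation_preserving_homeo h \<and> Y = map_arrow h ` X)"

lemma orientation_preserving_homeo_id: "orientation_preserving_homeo (\<lambda>z. z)"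
  unfolding orientation_preserving_homeo_def
  by (intro conjI exI[of _ "\<lambda>z. z"] homeomorphism_ident) (auto intro: strict_monoI)

lemma orientation_preserving_homeo_compose:
  assumes "orientation_preserving_homeo h" "orientation_preserving_homeo h'"
  shows "orientation_preserving_homeo (h' \<circ> h)"
proof -
  from assms obtain k f k' f' where
    k: "homeomorphism circle circle h k" "homeomorphism circle circle h' k'" and
    f: "continuous_on UNIV f" "strict_mono f" "\<And>t. h (cis t) = cis (f t)" and
    f': "continuous_on UNIV f'" "strict_mono f'" "\<And>t. h' (cis t) = cis (f' t)"
    unfolding orientation_preserving_homeo_def by blast
  have "continuous_on UNIV (f' \<circ> f)"
    using f(1) f'(1) by (metis continuous_on_compose continuous_on_subset subset_UNIV)
  moreover have "strict_mono (f' \<circ> f)"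
    using f(2) f'(2) by (simp add: strict_mono_def)
  moreover have "(h' \<circ> h) (cis t) = cis ((f' \<circ> f) t)" for t
    using f(3) f'(3) by simp
  ultimately show ?thesis
    unfolding orientation_preserving_homeo_def
    using homeomorphism_compose[OF k] by blast
qed

lemma orientation_preserving_homeo_inverse:
  assumes "orientation_preserving_homeo h"
  obtains k where "orientation_preserving_homeo k" "homeomorphism circle circle h k"
proof -
  from assms obtain k f where k: "homeomorphism circle circle h k"
    and f: "continuous_on UNIV f" "strict_mono f" "\<And>t. h (cis t) = cis (f t)"
    unfolding orientation_preserving_homeo_def by blast
  have step: "f (t + 2 * pi) \<ge> f t + 2 * pi" for t :: real
  proof -
    have "cis (t + 2 * pi) = cis t"
      by (simp add: complex_eq_iff)
    then have "cis (f (t + 2 * pi)) = cis (f t)"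
      by (metis f(3))
    then have "sin (f (t + 2 * pi)) = sin (f t) \<and> cos (f (t + 2 * pi)) = cos (f t)"
      by (simp add: complex_eq_iff)
    then obtain m :: int where m: "f (t + 2 * pi) = f t + 2 * pi * m"
      using sin_cos_eq_iff by (metis mult.assoc)
    have "f t < f (t + 2 * pi)"
      using f(2) by (simp add: strict_mono_def)
    then have "2 * pi * m > 0"
      using m by simp
    then have "m \<ge> 1"
      by (simp add: zero_less_mult_iff)
    then have "2 * pi * m \<ge> 2 * pi"
      by simp
    then show ?thesis
      using m by simp
  qed
  have up: "f (2 * pi * real j) \<ge> f 0 + 2 * pi * real j" for j
  proof (induction j)
    case (Suc j)
    then show ?case
      using step[of "2 * pi * real j"] by (simp add: algebra_simps)
  qed simp
  have down: "f (- (2 * pi * real j)) \<le> f 0 - 2 * pi * real j" for j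
  proof (induction j)
    case (Suc j)
    then show ?case
      using step[of "- (2 * pi * real (Suc j))"] by (simp add: algebra_simps)
  qed simp
  have surj: "\<exists>t. f t = y" for y
  proof -
    obtain j where j: "\<bar>y - f 0\<bar> < real j * (2 * pi)"
      using reals_Archimedean3[of "2 * pi"] by auto
    have "f (- (2 * pi * real j)) \<le> y" "y \<le> f (2 * pi * real j)"
      using up[of j] down[of j] j by (auto simp: algebra_simps abs_if split: if_splits)
    moreover have "- (2 * pi * real j) \<le> 2 * pi * real j"
      by simp
    moreover have "continuous_on {- (2 * pi * real j)..2 * pi * real j} f"
      using f(1) continuous_on_subset by blast
    ultimately show ?thesis
      using IVT'[of f _ y] by metis
  qed
  define g where "g = inv_into UNIV f"
  have fg: "f (g y) = y" for y
    unfolding g_def using surj by (metis f_inv_into_f rangeI)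
  have gf: "g (f t) = t" for t
    unfolding g_def using f(2) by (simp add: strict_mono_imp_inj_on)
  have g_mono: "strict_mono g"
    by (rule strict_monoI) (metis fg f(2) strict_mono_less)
  have "range g = UNIV"
    by (metis gf surjI)
  then have "continuous_on UNIV g"
    using g_mono by (intro continuous_onI_mono) (auto simp: strict_mono_less_eq)
  moreover have "k (cis t) = cis (g t)" for t
    by (metis fg f(3) homeomorphism_apply1[OF k] norm_cis mem_sphere_0)
  ultimately have "orientation_preserving_homeo k"
    unfolding orientation_preserving_homeo_def
    using g_mono homeomorphism_symD[OF k] by blast
  then show ?thesis
    using k that by blast
qed

lemma map_arrow_image_inverse:
  assumes "endpoints X \<subseteq> circle" "\<And>z. z \<in> circle \<Longrightarrow> k (h z) = z"
  shows "map_arrow k ` map_arrow h ` X = X"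
proof -
  have "map_arrow k (map_arrow h a) = a" if "a \<in> X" for a
    using that assms by (cases a) (auto simp: endpoints_def arrow_ends_def)
  then show ?thesis
    by (force simp: image_image)
qed

lemma diagram_equiv_part_equivp: "part_equivp diagram_equiv"
proof (rule part_equivpI)
  show "\<exists>X. diagram_equiv X X"
    by (rule exI[of _ "{}"])
      (use orientation_preserving_homeo_id in
        \<open>auto simp: diagram_equiv_def diagram_on_circle_def endpoints_def\<close>)
  show "symp diagram_equiv"
  proof (rule sympI)
    fix X Y assume XY: "diagram_equiv X Y"
    then obtain h where h: "orientation_preserving_homeo h" "Y = map_arrow h ` X"
      by (auto simp: diagram_equiv_def)
    obtain k where k: "orientation_preserving_homeo k" "homeomorphism circle circle h k"
      using orientation_preserving_homeo_inverse[OF h(1)] by blast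
    have "endpoints X \<subseteq> circle"
      using XY by (simp add: diagram_equiv_def diagram_on_circle_def)
    then have "X = map_arrow k ` Y"
      using map_arrow_image_inverse[of X k h] homeomorphism_apply1[OF k(2)] h(2) by simp
    then show "diagram_equiv Y X"
      using XY k(1) unfolding diagram_equiv_def by blast
  qed
  show "transp diagram_equiv"
  proof (rule transpI)
    fix X Y Z assume XY: "diagram_equiv X Y" and YZ: "diagram_equiv Y Z"
    then obtain h h' where h: "orientation_preserving_homeo h" "Y = map_arrow h ` X"
      and h': "orientation_preserving_homeo h'" "Z = map_arrow h' ` Y"
      by (auto simp: diagram_equiv_def)
    have "Z = map_arrow (h' \<circ> h) ` X"
      using h(2) h'(2) by (simp add: image_image arrow.map_comp)
    then show "diagram_equiv X Z"
      using XY YZ orientation_preserving_homeo_compose[OF h(1) h'(1)]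
      unfolding diagram_equiv_def by blast
  qed
qed

quotient_type gauss_diagram = "complex arrow set" / partial: diagram_equiv
  by (rule diagram_equiv_part_equivp)

text \<open>
  \<open>gauss X\<close> is the Gauss diagram presented by \<open>X\<close>; it is meaningful only when
  \<open>diagram_on_circle X\<close> holds.
\<close>

abbreviation gauss :: "complex arrow set \<Rightarrow> gauss_diagram" where
  "gauss \<equiv> abs_gauss_diagram"

lemma diagram_equiv_refl: "diagram_on_circle X \<Longrightarrow> diagram_equiv X X"
  unfolding diagram_equiv_def
  using orientation_preserving_homeo_id by (auto simp: arrow.map_ident)

lemma gauss_eq_iff:
  assumes "diagram_on_circle X" "diagram_on_circle Y"
  shows "gauss X = gauss Y \<longleftrightarrow> diagram_equiv X Y"
  using Quotient3_rel[OF Quotient3_gauss_diagram, of X Y] diagram_equiv_refl assms by blast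

lemma gauss_surj:
  obtains X where "diagram_on_circle X" "D = gauss X"
proof -
  have "diagram_equiv (rep_gauss_diagram D) (rep_gauss_diagram D)"
    using Quotient3_rep_reflp[OF Quotient3_gauss_diagram] .
  then show ?thesis
    using that Quotient3_abs_rep[OF Quotient3_gauss_diagram, of D]
    unfolding diagram_equiv_def by metis
qed

lemma diagram_on_circle_subset:
  "diagram_on_circle X \<Longrightarrow> Y \<subseteq> X \<Longrightarrow> diagram_on_circle Y"
  unfolding diagram_on_circle_def endpoints_def
  by (meson UN_mono finite_subset order_refl order_trans subsetD)

lemma map_arrow_inj_on:
  assumes "diagram_on_circle X" "orientation_preserving_homeo h"
  shows "inj_on (map_arrow h) X"
proof -
  obtain k where k: "homeomorphism circle circle h k"
    using orientation_preserving_homeo_inverse[OF assms(2)] by blast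
  have "map_arrow k (map_arrow h a) = a" if "a \<in> X" for a
    using that assms(1) homeomorphism_apply1[OF k]
    by (cases a) (auto simp: diagram_on_circle_def endpoints_def arrow_ends_def)
  then show ?thesis
    by (rule inj_on_inverseI)
qed

lift_definition num_arrows :: "gauss_diagram \<Rightarrow> nat" is card
  by (auto simp: diagram_equiv_def card_image map_arrow_inj_on)


section \<open>Reidemeister moves and virtual knots\<close>

text \<open>The open arc run through when going counterclockwise from \<open>p\<close> to \<open>q\<close> (for \<open>p \<noteq> q\<close>).\<close>

definition open_arc :: "complex \<Rightarrow> complex \<Rightarrow> complex set" where
  "open_arc p q =
     {z. \<exists>s t u. p = cis s \<and> z = cis t \<and> q = cis u \<and> s < t \<and> t < u \<and> u < s + 2 * pi}"

definition adjacent :: "complex arrow set \<Rightarrow> complex \<Rightarrow> complex \<Rightarrow> bool" where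
  "adjacent X p q \<longleftrightarrow> open_arc p q \<inter> endpoints X = {} \<or> open_arc q p \<inter> endpoints X = {}"

definition isolated_arrow :: "complex arrow set \<Rightarrow> complex arrow \<Rightarrow> bool" where
  "isolated_arrow X a \<longleftrightarrow> diagram_on_circle X \<and> a \<in> X \<and> adjacent X (tail a) (head a)"

definition cancelling_arrows ::
    "complex arrow set \<Rightarrow> complex arrow \<Rightarrow> complex arrow \<Rightarrow> bool" where
  "cancelling_arrows X a b \<longleftrightarrow>
     diagram_on_circle X \<and> a \<in> X \<and> b \<in> X \<and> a \<noteq> b \<and> arrow_sign a \<noteq> arrow_sign b \<and>
     adjacent X (tail a) (tail b) \<and> adjacent X (head a) (head b)"

text \<open>\<open>e\<close> is a closed arc on which \<open>p\<close> is followed by \<open>q\<close>.\<close>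

definition consecutive_on_arc :: "complex set \<Rightarrow> complex \<Rightarrow> complex \<Rightarrow> bool" where
  "consecutive_on_arc e p q \<longleftrightarrow>
     (\<exists>s t t' u. s \<le> t \<and> t < t' \<and> t' \<le> u \<and> u < s + 2 * pi \<and>
        e = cis ` {s..u} \<and> p = cis t \<and> q = cis t')"

text \<open>
  The two sides of the third move. The set \<open>T\<close> consists of the three arrows of the configuration
  in \<open>X\<close>, and \<open>T'\<close> of the three arrows replacing them in \<open>X'\<close>. The six endpoints stay where they
  are, and the two endpoints on each arc \<open>e\<^sub>i\<close> exchange the arrows to which they belong.
\<close>

definition triangle ::
    "complex arrow set \<Rightarrow> complex arrow set \<Rightarrow> complex arrow set \<Rightarrow> complex arrow set \<Rightarrow> bool"
  where
  "triangle X T X' T' \<longleftrightarrow>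
     (\<exists>e\<^sub>1 e\<^sub>2 e\<^sub>3 p\<^sub>1 q\<^sub>1 p\<^sub>2 q\<^sub>2 p\<^sub>3 q\<^sub>3.
        diagram_on_circle X \<and>
        e\<^sub>1 \<inter> e\<^sub>2 = {} \<and> e\<^sub>1 \<inter> e\<^sub>3 = {} \<and> e\<^sub>2 \<inter> e\<^sub>3 = {} \<and>
        consecutive_on_arc e\<^sub>1 p\<^sub>1 q\<^sub>1 \<and> consecutive_on_arc e\<^sub>2 p\<^sub>2 q\<^sub>2 \<and> consecutive_on_arc e\<^sub>3 p\<^sub>3 q\<^sub>3 \<and>
        e\<^sub>1 \<inter> endpoints X = {p\<^sub>1, q\<^sub>1} \<and> e\<^sub>2 \<inter> endpoints X = {p\<^sub>2, q\<^sub>2} \<and> e\<^sub>3 \<inter> endpoints X = {p\<^sub>3, q\<^sub>3} \<and>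
        T = {Arrow p\<^sub>1 p\<^sub>2 Pos, Arrow q\<^sub>1 p\<^sub>3 Pos, Arrow q\<^sub>2 q\<^sub>3 Pos} \<and>
        T' = {Arrow q\<^sub>1 q\<^sub>2 Pos, Arrow p\<^sub>1 q\<^sub>3 Pos, Arrow p\<^sub>2 p\<^sub>3 Pos} \<and>
        T \<subseteq> X \<and> X' = (X - T) \<union> T')"

inductive reidemeister_move :: "gauss_diagram \<Rightarrow> gauss_diagram \<Rightarrow> bool" where
  R1: "isolated_arrow X a \<Longrightarrow> reidemeister_move (gauss X) (gauss (X - {a}))"
| R2: "cancelling_arrows X a b \<Longrightarrow> reidemeister_move (gauss X) (gauss (X - {a, b}))"
| R3: "triangle X T X' T' \<Longrightarrow> reidemeister_move (gauss X) (gauss X')"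

quotient_type virtual_knot = gauss_diagram / "equivclp reidemeister_move"
  by simp

abbreviation knot :: "gauss_diagram \<Rightarrow> virtual_knot" where
  "knot \<equiv> abs_virtual_knot"


section \<open>Invariants of finite degree\<close>

text \<open>
  The free abelian group on a type \<open>'a\<close> is \<open>free_Abelian_group (UNIV :: 'a set)\<close>, with underlying
  type of finitely supported functions \<open>'a \<Rightarrow>\<^sub>0 int\<close>. Its group operation is written additively
  on that type, while arbitrary abelian groups are multiplicative as in \<open>HOL-Algebra\<close>.
\<close>

definition linear_extension ::
    "('g, 'm) monoid_scheme \<Rightarrow> ('a \<Rightarrow> 'g) \<Rightarrow> ('a \<Rightarrow>\<^sub>0 int) \<Rightarrow> 'g" where
  "linear_extension G \<nu> c =
     finprod G (\<lambda>x. \<nu> x [^]\<^bsub>G\<^esub> Poly_Mapping.lookup c x) (Poly_Mapping.keys c)"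

text \<open>
  The diagram \<open>X\<close> with the arrows in \<open>C\<close> made semi-virtual. A subset \<open>S\<close> of \<open>C\<close> is the set of
  arrows \<open>d\<^sub>i\<close> with \<open>\<sigma>\<^sub>i = 1\<close>.
\<close>

definition semi_virtual ::
    "complex arrow set \<Rightarrow> complex arrow set \<Rightarrow> (gauss_diagram \<Rightarrow>\<^sub>0 int)" where
  "semi_virtual X C = (\<Sum>S\<in>Pow C. frag_cmul ((-1) ^ card S) (frag_of (gauss (X - S))))"

definition knot_classes :: "(gauss_diagram \<Rightarrow>\<^sub>0 int) \<Rightarrow> (virtual_knot \<Rightarrow>\<^sub>0 int)" where
  "knot_classes = frag_extend (\<lambda>D. frag_of (knot D))"

definition invariant_of_degree_at_most ::
    "('g, 'm) monoid_scheme \<Rightarrow> nat \<Rightarrow> (virtual_knot \<Rightarrow> 'g) \<Rightarrow> bool" where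
  "invariant_of_degree_at_most G n \<nu> \<longleftrightarrow>
     (\<forall>K. \<nu> K \<in> carrier G) \<and>
     (\<forall>X C. diagram_on_circle X \<and> C \<subseteq> X \<and> card C > n \<longrightarrow>
        linear_extension G \<nu> (knot_classes (semi_virtual X C)) = \<one>\<^bsub>G\<^esub>)"


section \<open>The Polyak algebra\<close>

text \<open>
  Arrow diagrams are the same objects as Gauss diagrams, so the isomorphism \<open>i\<close> is the identity
  here.
\<close>

type_synonym arrow_diagram = gauss_diagram

abbreviation arrow_diagram_group :: "(arrow_diagram \<Rightarrow>\<^sub>0 int) monoid" where
  "arrow_diagram_group \<equiv> free_Abelian_group UNIV"

lift_definition subdiagram_sum :: "gauss_diagram \<Rightarrow> (arrow_diagram \<Rightarrow>\<^sub>0 int)" is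
  "\<lambda>X. \<Sum>Y\<in>Pow X. frag_of (gauss Y)"
proof -
  fix X X' assume eq: "diagram_equiv X X'"
  then obtain h where h: "orientation_preserving_homeo h" "X' = map_arrow h ` X"
    and X: "diagram_on_circle X" and X': "diagram_on_circle X'"
    by (auto simp: diagram_equiv_def)
  have "gauss Y = gauss (map_arrow h ` Y)" if "Y \<subseteq> X" for Y
  proof -
    have "diagram_on_circle Y" "diagram_on_circle (map_arrow h ` Y)"
      using that X X' h(2) by (auto intro: diagram_on_circle_subset)
    then show ?thesis
      using h(1) gauss_eq_iff unfolding diagram_equiv_def by blast
  qed
  moreover have "inj_on (image (map_arrow h)) (Pow X)"
    using map_arrow_inj_on[OF X h(1)] by (rule inj_on_image_Pow)
  moreover have "Pow X' = image (map_arrow h) ` Pow X"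
    using h(2) by (simp add: image_Pow_surj)
  ultimately show "(\<Sum>Y\<in>Pow X. frag_of (gauss Y)) = (\<Sum>Y\<in>Pow X'. frag_of (gauss Y))"
    by (simp add: sum.reindex)
qed

definition I_map :: "(gauss_diagram \<Rightarrow>\<^sub>0 int) \<Rightarrow> (arrow_diagram \<Rightarrow>\<^sub>0 int)" where
  "I_map = frag_extend subdiagram_sum"

definition triangle_sum ::
    "complex arrow set \<Rightarrow> complex arrow set \<Rightarrow> (arrow_diagram \<Rightarrow>\<^sub>0 int)" where
  "triangle_sum X T = (\<Sum>S | S \<subseteq> T \<and> 2 \<le> card S. frag_of (gauss (X - (T - S))))"

inductive_set polyak_relators :: "(arrow_diagram \<Rightarrow>\<^sub>0 int) set" where
  P1: "isolated_arrow X a \<Longrightarrow> frag_of (gauss X) \<in> polyak_relators"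
| P2: "cancelling_arrows X a b \<Longrightarrow>
         frag_of (gauss X) + frag_of (gauss (X - {b})) + frag_of (gauss (X - {a}))
           \<in> polyak_relators"
| P3: "triangle X T X' T' \<Longrightarrow> triangle_sum X T - triangle_sum X' T' \<in> polyak_relators"

definition polyak_kernel :: "(arrow_diagram \<Rightarrow>\<^sub>0 int) set" where
  "polyak_kernel = generate arrow_diagram_group polyak_relators"

definition polyak :: "(arrow_diagram \<Rightarrow>\<^sub>0 int) set monoid" where
  "polyak = arrow_diagram_group Mod polyak_kernel"

definition polyak_class :: "(arrow_diagram \<Rightarrow>\<^sub>0 int) \<Rightarrow> (arrow_diagram \<Rightarrow>\<^sub>0 int) set" where
  "polyak_class x = polyak_kernel #>\<^bsub>arrow_diagram_group\<^esub> x"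

definition truncation_kernel :: "nat \<Rightarrow> (arrow_diagram \<Rightarrow>\<^sub>0 int) set set" where
  "truncation_kernel n = generate polyak {polyak_class (frag_of D) |D. num_arrows D > n}"

definition polyak_trunc :: "nat \<Rightarrow> (arrow_diagram \<Rightarrow>\<^sub>0 int) set set monoid" where
  "polyak_trunc n = polyak Mod truncation_kernel n"

definition polyak_trunc_class ::
    "nat \<Rightarrow> (arrow_diagram \<Rightarrow>\<^sub>0 int) \<Rightarrow> (arrow_diagram \<Rightarrow>\<^sub>0 int) set set" where
  "polyak_trunc_class n x = truncation_kernel n #>\<^bsub>polyak\<^esub> polyak_class x"

text \<open>The common value of the class of \<open>I(D)\<close> on all Gauss diagrams \<open>D\<close> of the knot.\<close>

definition I_trunc :: "nat \<Rightarrow> virtual_knot \<Rightarrow> (arrow_diagram \<Rightarrow>\<^sub>0 int) set set" where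
  "I_trunc n K = (THE x. \<forall>D. knot D = K \<longrightarrow> x = polyak_trunc_class n (I_map (frag_of D)))"

end

theory Submission
  imports Defs
begin

text \<open>
  A Reidemeister move replaces a set \<open>T\<close> of arrows by a set \<open>T'\<close> and keeps the remaining arrows
  \<open>Z\<close>. Writing \<open>\<Sigma>(Z, T)\<close> for the sum of \<open>Z \<union> S\<close> over all \<open>S \<subseteq> T\<close>, the relators of the Polyak
  algebra are the differences \<open>\<Sigma>(Z, T) - \<Sigma>(Z, T')\<close>, and every \<open>Y \<subseteq> Z\<close> admits the same move. Hence
  \<open>I(Z \<union> T) - I(Z \<union> T')\<close>, the sum of \<open>\<Sigma>(Y, T) - \<Sigma>(Y, T')\<close> over \<open>Y \<subseteq> Z\<close>, vanishes in the Polyak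
  algebra. The map \<open>I\<close> sends a diagram with semi-virtual arrows \<open>C\<close> to the sum of its subdiagrams
  that contain \<open>C\<close>, which gives the bound on the degree.

  Conversely, the inverse \<open>J\<close> of \<open>I\<close> makes all arrows of a diagram semi-virtual, and it sends
  \<open>\<Sigma>(Z, T)\<close> to \<open>Z \<union> T\<close> with \<open>Z\<close> semi-virtual. So for an invariant \<open>\<nu>\<close> of degree at most \<open>n\<close> the map
  \<open>\<nu> \<circ> J\<close> kills the relators, because \<open>\<nu>\<close> is invariant under moves, and the diagrams with more
  than \<open>n\<close> arrows, because of the degree. It factors through the truncated algebra, and
  \<open>\<nu> \<circ> J \<circ> I = \<nu>\<close>.
\<close>

section \<open>Sliding endpoints along arcs\<close>

text \<open>The chord has length \<open>2 * \<bar>sin ((x - y) / 2)\<bar>\<close>, hence at most the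
  arc. This is the Lipschitz bound that makes the lift in \<open>slidable_near\<close>
  increasing.\<close>

lemma norm_cis_diff_le: "norm (cis x - cis y) \<le> \<bar>x - y\<bar>"
proof -
  have "cis x - cis y = cis y * (exp (\<i> * of_real (x - y)) - 1)"
    by (simp add: cis_conv_exp algebra_simps flip: exp_add)
  then have "norm (cis x - cis y) = 2 * \<bar>sin ((x - y) / 2)\<bar>"
    by (metis dist_exp_i_1 mult_1 norm_cis norm_mult)
  then show ?thesis
    using abs_sin_x_le_abs_x[of "(x - y) / 2"] by simp
qed

lemma cis_eq_imp:
  assumes "cis x = cis y"
  obtains m :: int where "x = y + 2 * pi * m"
proof -
  have "sin x = sin y \<and> cos x = cos y"
    using assms by (simp add: complex_eq_iff)
  then show ?thesis
    using that sin_cos_eq_iff by (metis mult.assoc)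
qed

lemma cis_shift: "cis (x + 2 * pi * of_int m) = cis x"
  by (metis cis_multiple_2pi cis_mult Ints_of_int mult.right_neutral)

lemma cis_neq:
  assumes "x < y" "y < x + 2 * pi"
  shows "cis x \<noteq> cis y"
proof
  assume "cis x = cis y"
  then obtain m :: int where m: "y = x + 2 * pi * m"
    using cis_eq_imp by metis
  with assms have "0 < m" "m < 1"
    by (auto simp: zero_less_mult_iff)
  then show False by linarith
qed

text \<open>If two image points agree, their lifts differ by a multiple of \<open>2 * pi\<close>;
  \<open>shift\<close> moves this multiple to the arguments and \<open>f\<close> is injective, so
  \<open>h\<close> is injective. A continuous bijection of the compact circle is a
  homeomorphism.\<close>

lemma orientation_preserving_homeo_lift:
  assumes f: "continuous_on UNIV f" "strict_mono f"
    and shift: "\<And>x. f (x + 2 * pi) = f x + 2 * pi"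
    and surj: "range f = UNIV"
    and h: "continuous_on circle h" "\<And>x. h (cis x) = cis (f x)"
  shows "orientation_preserving_homeo h"
proof -
  have shift_nat: "f (x + 2 * pi * real m) = f x + 2 * pi * real m" for x m
  proof (induction m)
    case (Suc m)
    then show ?case
      using shift[of "x + 2 * pi * real m"] by (simp add: algebra_simps)
  qed simp
  have shift_int: "f (x + 2 * pi * of_int m) = f x + 2 * pi * of_int m" for x m
  proof (cases m)
    case (nonneg k)
    then show ?thesis using shift_nat by simp
  next
    case (neg k)
    then have m: "real_of_int m = - real (Suc k)"
      by simp
    \<comment> \<open>For negative \<open>m\<close>, the shift by \<open>Suc k\<close> full turns is
      applied at \<open>x + 2 * pi * of_int m\<close> and ends at \<open>x\<close>.\<close>
    show ?thesis
      using shift_nat[of "x + 2 * pi * of_int m" "Suc k"] unfolding m by (simp add: algebra_simps)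
  qed
  have "z \<in> range cis" if "z \<in> circle" for z
    using that rcis_cmod_Arg[of z] by (intro range_eqI[of _ _ "Arg z"]) (simp add: rcis_def)
  then have circle: "circle = range cis"
    by auto
  have "h ` circle = circle"
    using surj h(2) by (simp add: circle image_image) (metis image_image)
  moreover have "inj_on h circle"
  proof (rule inj_onI)
    fix z w assume "z \<in> circle" "w \<in> circle" and eq: "h z = h w"
    then obtain x y where xy: "z = cis x" "w = cis y"
      by (auto simp: circle)
    then obtain m :: int where "f x = f y + 2 * pi * m"
      using eq h(2) cis_eq_imp by metis
    then have "f x = f (y + 2 * pi * m)"
      by (simp add: shift_int)
    then have "x = y + 2 * pi * m"
      using f(2) by (simp add: strict_mono_eq)
    then show "z = w"
      using xy cis_shift by simp
  qed
  ultimately obtain k where "homeomorphism circle circle h k"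
    using homeomorphism_compact[OF compact_sphere h(1)] by blast
  then show ?thesis
    unfolding orientation_preserving_homeo_def using f h(2) by blast
qed

text \<open>\<open>F\<close> will hold the endpoints that must stay in place while a single endpoint
  moves; motions of several endpoints are composed from such slides.\<close>

definition slidable :: "complex set \<Rightarrow> complex \<Rightarrow> complex \<Rightarrow> bool" where
  "slidable F p q \<longleftrightarrow>
     (\<exists>h. orientation_preserving_homeo h \<and> h p = q \<and> (\<forall>z\<in>F. h z = z))"

lemma slidable_trans: "slidable F p q \<Longrightarrow> slidable F q r \<Longrightarrow> slidable F p r"
  unfolding slidable_def
  by (metis comp_apply orientation_preserving_homeo_compose)

text \<open>Off the circle nothing relates \<open>h\<close> to its inverse, so \<open>F\<close> and
  \<open>p\<close> have to lie on it.\<close>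

lemma slidable_sym:
  assumes "slidable F p q" "F \<subseteq> circle" "p \<in> circle"
  shows "slidable F q p"
proof -
  obtain h where h: "orientation_preserving_homeo h" "h p = q" "\<forall>z\<in>F. h z = z"
    using assms(1) by (auto simp: slidable_def)
  obtain k where k: "orientation_preserving_homeo k" "homeomorphism circle circle h k"
    using orientation_preserving_homeo_inverse[OF h(1)] by blast
  then have "k (h z) = z" if "z \<in> circle" for z
    using that by (simp add: homeomorphism_def)
  then show ?thesis
    unfolding slidable_def using k(1) h assms(2,3) by (metis subsetD)
qed

text \<open>
  The homeomorphism rotates each point by a fixed multiple \<open>c\<close> of its distance to \<open>F\<close>. Since this
  distance is a 1-Lipschitz function of the angle, the lift is increasing for \<open>\<bar>c\<bar> < 1\<close>.
\<close>

lemma slidable_near: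
  assumes "\<bar>y - x\<bar> < infdist (cis x) F"
  shows "slidable F (cis x) (cis y)"
proof -
  define d where "d = infdist (cis x) F"
  \<comment> \<open>With this factor the angle \<open>x\<close> is displaced by exactly
    \<open>c * d = y - x\<close>, and the assumption becomes
    \<open>\<bar>c\<bar> < 1\<close>.\<close>
  define c where "c = (y - x) / d"
  have d: "d > 0" using assms by (simp add: d_def)
  then have c: "\<bar>c\<bar> < 1" using assms by (simp add: c_def d_def)
  define f where "f = (\<lambda>t. t + c * infdist (cis t) F)"
  define h where "h = (\<lambda>z. z * cis (c * infdist z F))"
  have hf: "h (cis t) = cis (f t)" for t
    by (simp add: h_def f_def cis_mult)
  have lip: "\<bar>c * infdist (cis s) F - c * infdist (cis t) F\<bar> \<le> \<bar>c\<bar> * \<bar>s - t\<bar>" for s t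
  proof -
    have "\<bar>infdist (cis s) F - infdist (cis t) F\<bar> \<le> \<bar>s - t\<bar>"
      using infdist_triangle_abs[of "cis s" F "cis t"] norm_cis_diff_le[of s t]
      by (simp add: dist_norm)
    then show ?thesis
      by (metis abs_ge_zero abs_mult mult_left_mono right_diff_distrib)
  qed
  have mono: "strict_mono f"
  proof (rule strict_monoI)
    fix s t :: real assume "s < t"
    then have "\<bar>c\<bar> * \<bar>s - t\<bar> < t - s"
      using c by simp
    then show "f s < f t"
      using lip[of s t] by (simp add: f_def)
  qed
  have cont: "continuous_on UNIV f"
    unfolding f_def by (intro continuous_intros continuous_on_infdist continuous_on_cis)
  have surj: "\<exists>t. f t = u" for u
  proof -
    \<comment> \<open>\<open>M\<close> bounds every displacement \<open>f t - t\<close>, since the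
      circle has diameter 2. So \<open>f\<close> takes values on both sides of \<open>u\<close> at
      \<open>u - M\<close> and \<open>u + M\<close>.\<close>
    define M where "M = infdist (cis 0) F + 2"
    have "\<bar>c * infdist (cis t) F\<bar> \<le> M" for t
    proof -
      have "infdist (cis t) F \<le> infdist (cis 0) F + dist (cis t) (cis 0)"
        by (rule infdist_triangle)
      also have "dist (cis t) (cis 0) \<le> 2"
        by (metis dist_norm norm_cis norm_triangle_ineq4 one_add_one)
      finally have "infdist (cis t) F \<le> M"
        by (simp add: M_def)
      moreover have "\<bar>c * infdist (cis t) F\<bar> \<le> 1 * infdist (cis t) F"
        unfolding abs_mult using c infdist_nonneg[of "cis t" F] by (intro mult_mono) auto
      ultimately show ?thesis by linarith
    qed
    then have "f (u - M) \<le> u" "u \<le> f (u + M)"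
      unfolding f_def by (smt (verit))+
    moreover have "u - M \<le> u + M"
      using infdist_nonneg[of "cis 0" F] by (simp add: M_def)
    moreover have "continuous_on {u - M..u + M} f"
      using cont continuous_on_subset by blast
    ultimately show ?thesis
      using IVT'[of f _ u] by metis
  qed
  have "orientation_preserving_homeo h"
  proof (rule orientation_preserving_homeo_lift[OF cont mono])
    show "f (t + 2 * pi) = f t + 2 * pi" for t
      using cis_shift[of t 1] by (simp add: f_def)
    show "range f = UNIV"
      using surj by (metis surjI)
    show "continuous_on circle h"
      unfolding h_def by (intro continuous_intros continuous_on_infdist continuous_on_cis)
  qed (rule hf)
  moreover have "h (cis x) = cis y"
    using d by (simp add: hf f_def c_def flip: d_def)
  moreover have "h z = z" if "z \<in> F" for z
    using that by (simp add: h_def)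
  ultimately show ?thesis
    unfolding slidable_def by blast
qed

text \<open>\<open>slidable_near\<close> gives only small motions, but it makes the classes of the
  equivalence relation of sliding open in the parameter interval, which is connected.
  \<open>F\<close> has to be nonempty because \<open>infdist\<close> to the empty set is 0.\<close>

lemma slidable_arc:
  assumes F: "finite F" "F \<noteq> {}" "F \<subseteq> circle"
    and e: "e = cis ` {s..u}" "e \<inter> F = {}" "p \<in> e" "q \<in> e"
  shows "slidable F p q"
proof -
  obtain x y where xy: "x \<in> {s..u}" "y \<in> {s..u}" and pq: "p = cis x" "q = cis y"
    using e by blast
  show ?thesis
    unfolding pq
  proof (rule connected_equivalence_relation[OF connected_Icc[of s u] xy])
    show "slidable F (cis b) (cis a)" if "slidable F (cis a) (cis b)" for a b
      using that F(3) slidable_sym by simp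
    show "slidable F (cis a) (cis c)"
      if "slidable F (cis a) (cis b)" "slidable F (cis b) (cis c)" for a b c
      using that slidable_trans by blast
    fix a assume a: "a \<in> {s..u}"
    then have "cis a \<notin> F"
      using e by blast
    then have "infdist (cis a) F > 0"
      using F(1,2) by (simp add: infdist_pos_not_in_closed finite_imp_closed)
    then show "\<exists>T. openin (top_of_set {s..u}) T \<and> a \<in> T \<and> (\<forall>b\<in>T. slidable F (cis a) (cis b))"
      using a slidable_near[of _ a F]
      by (intro exI[of _ "{s..u} \<inter> ball a (infdist (cis a) F)"])
        (auto simp: dist_real_def abs_minus_commute)
  qed
qed

section \<open>Unions of diagrams and their images under homeomorphisms\<close>

lemma endpoints_simps [simp]:
  "endpoints {} = {}"
  "endpoints (insert a X) = insert (tail a) (insert (head a) (endpoints X))"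
  "endpoints (X \<union> Y) = endpoints X \<union> endpoints Y"
  by (auto simp: endpoints_def arrow_ends_def)

lemma endpoints_mono: "X \<subseteq> Y \<Longrightarrow> endpoints X \<subseteq> endpoints Y"
  by (auto simp: endpoints_def)

lemma endpoints_disjoint_imp_disjoint: "endpoints X \<inter> endpoints Y = {} \<Longrightarrow> X \<inter> Y = {}"
  by (auto simp: endpoints_def arrow_ends_def)

text \<open>The right-hand side sees how \<open>X\<close> and \<open>Y\<close> interact only through
  their endpoints. Hence \<open>Y\<close> may be exchanged for another diagram with the same
  endpoints, as the third move does.\<close>

lemma diagram_on_circle_Un:
  "diagram_on_circle (X \<union> Y) \<and> X \<inter> Y = {} \<longleftrightarrow>
     diagram_on_circle X \<and> diagram_on_circle Y \<and> endpoints X \<inter> endpoints Y = {}"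
  (is "?l \<longleftrightarrow> ?r")
proof
  assume l: ?l
  have "arrow_ends a \<inter> arrow_ends b = {}" if "a \<in> X" "b \<in> Y" for a b
  proof -
    have "a \<noteq> b" "a \<in> X \<union> Y" "b \<in> X \<union> Y"
      using l that by auto
    then show ?thesis
      using l unfolding diagram_on_circle_def by blast
  qed
  then have "endpoints X \<inter> endpoints Y = {}"
    unfolding endpoints_def by blast
  then show ?r
    using l diagram_on_circle_subset by blast
next
  assume r: ?r
  then have XY: "arrow_ends a \<inter> arrow_ends b = {}" if "a \<in> X" "b \<in> Y" for a b
    using that unfolding endpoints_def by blast
  have "arrow_ends a \<inter> arrow_ends b = {}" if ab: "a \<in> X \<union> Y" "b \<in> X \<union> Y" "a \<noteq> b" for a b
  proof -
    consider "a \<in> X" "b \<in> X" | "a \<in> X" "b \<in> Y" | "a \<in> Y" "b \<in> X" | "a \<in> Y" "b \<in> Y"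
      using ab by blast
    then show ?thesis
      using r XY ab(3) unfolding diagram_on_circle_def by cases (metis Int_commute)+
  qed
  then have "diagram_on_circle (X \<union> Y)"
    using r by (auto simp: diagram_on_circle_def simp del: Int_iff)
  then show ?l
    using r endpoints_disjoint_imp_disjoint by blast
qed

lemma diagram_on_circle_image:
  assumes X: "diagram_on_circle X" and h: "orientation_preserving_homeo h"
  shows "diagram_on_circle (map_arrow h ` X)"
proof -
  obtain k where k: "homeomorphism circle circle h k"
    using orientation_preserving_homeo_inverse[OF h] by blast
  have ends: "arrow_ends (map_arrow h a) = h ` arrow_ends a" for a
    by (cases a) (simp add: arrow_ends_def)
  have im: "h ` circle = circle"
    using k by (rule homeomorphism_image1)
  have inj: "inj_on h circle"
    using homeomorphism_apply1[OF k] by (rule inj_on_inverseI)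
  have "endpoints (map_arrow h ` X) = h ` endpoints X"
    by (simp add: endpoints_def ends image_UN)
  then have sub: "endpoints (map_arrow h ` X) \<subseteq> circle"
    using X im by (metis diagram_on_circle_def image_mono)
  have ac: "arrow_ends a \<subseteq> circle" if "a \<in> X" for a
    using X that by (auto simp: diagram_on_circle_def endpoints_def)
  have loop: "tail (map_arrow h a) \<noteq> head (map_arrow h a)" if "a \<in> X" for a
  proof -
    have "tail a \<noteq> head a" "tail a \<in> circle" "head a \<in> circle"
      using X that ac[OF that] by (simp_all add: diagram_on_circle_def arrow_ends_def)
    then show ?thesis
      by (simp add: arrow.map_sel inj_on_eq_iff[OF inj])
  qed
  have ends_disj: "arrow_ends (map_arrow h a) \<inter> arrow_ends (map_arrow h b) = {}"
    if "a \<in> X" "b \<in> X" "a \<noteq> b" for a b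
  proof -
    have "arrow_ends a \<inter> arrow_ends b = {}"
      using X that unfolding diagram_on_circle_def by blast
    then show ?thesis
      using inj_on_image_Int[OF inj ac[OF that(1)] ac[OF that(2)]] by (simp add: ends)
  qed
  have "finite (map_arrow h ` X)"
    using X by (simp add: diagram_on_circle_def)
  then show ?thesis
    unfolding diagram_on_circle_def
  proof (intro conjI ballI impI)
    fix a' assume "a' \<in> map_arrow h ` X"
    then show "tail a' \<noteq> head a'"
      using loop by (elim imageE) simp
    fix b' assume "a' \<in> map_arrow h ` X" "b' \<in> map_arrow h ` X" "a' \<noteq> b'"
    then show "arrow_ends a' \<inter> arrow_ends b' = {}"
      using ends_disj by (elim imageE) metis
  qed (use sub in auto)
qed

lemma gauss_image:
  assumes "diagram_on_circle X" "orientation_preserving_homeo h"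
  shows "gauss (map_arrow h ` X) = gauss X"
  using assms diagram_on_circle_image gauss_eq_iff unfolding diagram_equiv_def by metis

text \<open>The tail slides first, with \<open>q\<close> fixed, then the head, with the new tail
  \<open>p'\<close> fixed; both slides fix the endpoints of \<open>Y\<close>. Including
  \<open>q\<close> or \<open>p'\<close> also keeps the fixed set nonempty when \<open>Y\<close> is
  empty.\<close>

lemma gauss_slide_arrow:
  assumes diag: "diagram_on_circle (insert (Arrow p q \<sigma>) Y)"
    and e: "e = cis ` {s..u}" "p \<in> e" "p' \<in> e"
    and e': "e' = cis ` {s'..u'}" "q \<in> e'" "q' \<in> e'"
    and disj: "e \<inter> e' = {}" "e \<inter> endpoints Y = {}" "e' \<inter> endpoints Y = {}"
  shows "gauss (insert (Arrow p' q' \<sigma>) Y) = gauss (insert (Arrow p q \<sigma>) Y)"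
proof -
  have Y: "finite Y" "endpoints Y \<subseteq> circle"
    using diag by (auto simp: diagram_on_circle_def)
  then have fin: "finite (endpoints Y)"
    by (auto simp: endpoints_def arrow_ends_def)
  have circ: "e \<subseteq> circle" "e' \<subseteq> circle"
    using e(1) e'(1) by auto
  have "slidable (insert q (endpoints Y)) p p'"
    by (rule slidable_arc[OF _ _ _ e(1) _ e(2,3)]) (use e'(2) disj fin Y(2) circ in auto)
  moreover have "slidable (insert p' (endpoints Y)) q q'"
    by (rule slidable_arc[OF _ _ _ e'(1) _ e'(2,3)]) (use e(3) disj fin Y(2) circ in auto)
  ultimately obtain h h' where h: "orientation_preserving_homeo h" "h p = p'" "h q = q"
      "\<And>z. z \<in> endpoints Y \<Longrightarrow> h z = z"
    and h': "orientation_preserving_homeo h'" "h' q = q'" "h' p' = p'"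
      "\<And>z. z \<in> endpoints Y \<Longrightarrow> h' z = z"
    by (auto simp: slidable_def)
  have "map_arrow (h' \<circ> h) a = a" if "a \<in> Y" for a
  proof -
    have "tail a \<in> endpoints Y" "head a \<in> endpoints Y"
      using that by (auto simp: endpoints_def arrow_ends_def)
    then show ?thesis
      using h(4) h'(4) by (cases a) simp
  qed
  then have "map_arrow (h' \<circ> h) ` insert (Arrow p q \<sigma>) Y = insert (Arrow p' q' \<sigma>) Y"
    using h h' by simp
  then show ?thesis
    using gauss_image[OF diag orientation_preserving_homeo_compose[OF h(1) h'(1)]] by simp
qed

section \<open>Moves and relators\<close>

lemma adjacent_subset: "adjacent X p q \<Longrightarrow> Y \<subseteq> X \<Longrightarrow> adjacent Y p q"
  using endpoints_mono[of Y X] by (auto simp: adjacent_def)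

section \<open>Sums over subsets of arrows\<close>

definition subset_sum :: "complex arrow set \<Rightarrow> complex arrow set \<Rightarrow> (gauss_diagram \<Rightarrow>\<^sub>0 int)" where
  "subset_sum Z T = (\<Sum>S\<in>Pow T. frag_of (gauss (Z \<union> S)))"

lemma subset_sum_empty [simp]: "subset_sum Z {} = frag_of (gauss Z)"
  by (simp add: subset_sum_def)

lemma sum_Pow_insert:
  fixes f :: "'a set \<Rightarrow> 'b::ab_group_add"
  assumes "finite T" "a \<notin> T"
  shows "sum f (Pow (insert a T)) = sum f (Pow T) + (\<Sum>S\<in>Pow T. f (insert a S))"
proof -
  have "inj_on (insert a) (Pow T)"
    using assms by (auto simp: inj_on_def)
  then show ?thesis
    using assms by (subst Pow_insert, subst sum.union_disjoint) (auto simp: sum.reindex)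
qed

text \<open>The subsets are split by whether they contain \<open>a\<close>. This recursion drives
  the later inductions on sets of arrows.\<close>

lemma subset_sum_insert:
  assumes "finite T" "a \<notin> T"
  shows "subset_sum Z (insert a T) = subset_sum Z T + subset_sum (insert a Z) T"
  using assms by (simp add: subset_sum_def sum_Pow_insert)

lemma subset_sum_diff:
  assumes "Z \<inter> T = {}"
  shows "subset_sum Z T = (\<Sum>S\<in>Pow T. frag_of (gauss (Z \<union> T - (T - S))))"
  unfolding subset_sum_def
proof (rule sum.cong[OF refl])
  fix S assume "S \<in> Pow T"
  then have "Z \<union> T - (T - S) = Z \<union> S"
    using assms by blast
  then show "frag_of (gauss (Z \<union> S)) = frag_of (gauss (Z \<union> T - (T - S)))"
    by simp
qed

text \<open>\<open>triangle_sum\<close> omits the empty subset and the singletons. They are isolated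
  here so that they can cancel between the two sides of a move.\<close>

lemma subset_sum_triangle_sum:
  assumes "finite T" "Z \<inter> T = {}"
  shows "subset_sum Z T =
    triangle_sum (Z \<union> T) T + frag_of (gauss Z) + (\<Sum>a\<in>T. frag_of (gauss (insert a Z)))"
proof -
  define g where "g = (\<lambda>S. frag_of (gauss (Z \<union> T - (T - S))))"
  have "card S \<le> 1 \<longleftrightarrow> S = {} \<or> (\<exists>a. S = {a})" if "S \<subseteq> T" for S
    using that assms(1) finite_subset
    by (metis One_nat_def Suc_leI card.empty card_1_singletonE card_0_eq is_singletonI is_singleton_altdef
        le_SucE le_zero_eq order_refl zero_le)
  then have small: "{S. S \<subseteq> T \<and> \<not> 2 \<le> card S} = insert {} ((\<lambda>a. {a}) ` T)"
    by (auto simp: not_le less_Suc_eq_le numeral_2_eq_2)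
  have "subset_sum Z T = sum g {S. S \<subseteq> T \<and> 2 \<le> card S} + sum g {S. S \<subseteq> T \<and> \<not> 2 \<le> card S}"
    unfolding subset_sum_diff[OF assms(2)] g_def using assms(1)
    by (subst sum.union_disjoint[symmetric]) (auto intro!: sum.cong)
  also have "sum g {S. S \<subseteq> T \<and> \<not> 2 \<le> card S} = g {} + (\<Sum>a\<in>T. g {a})"
    unfolding small using assms(1) by (subst sum.insert) (auto simp: sum.reindex)
  also have "g {} = frag_of (gauss Z)"
    using assms(2) by (simp add: g_def Un_Diff Diff_triv)
  also have "(\<Sum>a\<in>T. g {a}) = (\<Sum>a\<in>T. frag_of (gauss (insert a Z)))"
  proof (rule sum.cong[OF refl])
    fix a assume "a \<in> T"
    then have "Z \<union> T - (T - {a}) = insert a Z"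
      using assms by blast
    then show "g {a} = frag_of (gauss (insert a Z))"
      by (simp add: g_def)
  qed
  finally show ?thesis
    by (simp add: triangle_sum_def g_def)
qed

text \<open>
  The three moves in uniform shape: the arrows \<open>T\<close> are replaced by \<open>T'\<close>, next to the unchanged
  arrows \<open>Z\<close>. The relators of the Polyak algebra are then exactly the differences
  \<open>subset_sum Z T - subset_sum Z T'\<close>; for the third move, the subsets with at most one arrow give
  the same Gauss diagrams on both sides and cancel.
\<close>

inductive local_move ::
    "complex arrow set \<Rightarrow> complex arrow set \<Rightarrow> complex arrow set \<Rightarrow> bool" where
  L1: "isolated_arrow (insert a Z) a \<Longrightarrow> a \<notin> Z \<Longrightarrow> local_move Z {a} {}"
| L2: "cancelling_arrows (Z \<union> {a, b}) a b \<Longrightarrow> Z \<inter> {a, b} = {} \<Longrightarrow> local_move Z {a, b} {}"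
| L3: "triangle (Z \<union> T) T (Z \<union> T') T' \<Longrightarrow> Z \<inter> T = {} \<Longrightarrow> local_move Z T T'"

section \<open>Geometry of the third move\<close>

lemma consecutive_on_arcE:
  assumes "consecutive_on_arc e p q"
  obtains s u where "e = cis ` {s..u}" "p \<in> e" "q \<in> e" "p \<noteq> q"
proof -
  obtain s t t' u where *: "s \<le> t" "t < t'" "t' \<le> u" "u < s + 2 * pi"
     "e = cis ` {s..u}" "p = cis t" "q = cis t'"
    using assms by (auto simp: consecutive_on_arc_def)
  then have "p \<noteq> q"
    using cis_neq[of t t'] by simp
  then show ?thesis
    using * by (intro that[of s u]) auto
qed

lemma triangleE:
  assumes "triangle X T X' T'"
  obtains e\<^sub>1 e\<^sub>2 e\<^sub>3 p\<^sub>1 q\<^sub>1 p\<^sub>2 q\<^sub>2 p\<^sub>3 q\<^sub>3 where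
    "diagram_on_circle X" "e\<^sub>1 \<inter> e\<^sub>2 = {}" "e\<^sub>1 \<inter> e\<^sub>3 = {}" "e\<^sub>2 \<inter> e\<^sub>3 = {}"
    "consecutive_on_arc e\<^sub>1 p\<^sub>1 q\<^sub>1" "consecutive_on_arc e\<^sub>2 p\<^sub>2 q\<^sub>2" "consecutive_on_arc e\<^sub>3 p\<^sub>3 q\<^sub>3"
    "e\<^sub>1 \<inter> endpoints X = {p\<^sub>1, q\<^sub>1}" "e\<^sub>2 \<inter> endpoints X = {p\<^sub>2, q\<^sub>2}" "e\<^sub>3 \<inter> endpoints X = {p\<^sub>3, q\<^sub>3}"
    "T = {Arrow p\<^sub>1 p\<^sub>2 Pos, Arrow q\<^sub>1 p\<^sub>3 Pos, Arrow q\<^sub>2 q\<^sub>3 Pos}"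
    "T' = {Arrow q\<^sub>1 q\<^sub>2 Pos, Arrow p\<^sub>1 q\<^sub>3 Pos, Arrow p\<^sub>2 p\<^sub>3 Pos}"
  using assms unfolding triangle_def by (elim exE conjE) (rule that; assumption)

text \<open>The six endpoints on the arcs all belong to \<open>T\<close>, so deleting arrows of
  \<open>Z\<close> does not change what the arcs meet.\<close>

lemma triangle_subset:
  assumes "triangle (Z \<union> T) T (Z \<union> T') T'" "Z \<inter> T = {}" "Y \<subseteq> Z"
  shows "triangle (Y \<union> T) T (Y \<union> T') T'"
proof -
  have d: "diagram_on_circle (Y \<union> T)" if "diagram_on_circle (Z \<union> T)"
    using that assms(3) diagram_on_circle_subset by blast
  have Y: "Y \<union> T' = (Y \<union> T - T) \<union> T'"
    using assms(2,3) by blast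
  have e: "e \<inter> endpoints (Y \<union> T) = {p, q}"
    if "e \<inter> endpoints (Z \<union> T) = {p, q}" "p \<in> endpoints T" "q \<in> endpoints T" for e p q
    using that endpoints_mono[OF assms(3)] by auto
  obtain e\<^sub>1 e\<^sub>2 e\<^sub>3 p\<^sub>1 q\<^sub>1 p\<^sub>2 q\<^sub>2 p\<^sub>3 q\<^sub>3 where t:
    "diagram_on_circle (Z \<union> T)"
    "e\<^sub>1 \<inter> e\<^sub>2 = {}" "e\<^sub>1 \<inter> e\<^sub>3 = {}" "e\<^sub>2 \<inter> e\<^sub>3 = {}"
    "consecutive_on_arc e\<^sub>1 p\<^sub>1 q\<^sub>1" "consecutive_on_arc e\<^sub>2 p\<^sub>2 q\<^sub>2" "consecutive_on_arc e\<^sub>3 p\<^sub>3 q\<^sub>3"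
    "e\<^sub>1 \<inter> endpoints (Z \<union> T) = {p\<^sub>1, q\<^sub>1}" "e\<^sub>2 \<inter> endpoints (Z \<union> T) = {p\<^sub>2, q\<^sub>2}"
    "e\<^sub>3 \<inter> endpoints (Z \<union> T) = {p\<^sub>3, q\<^sub>3}"
    "T = {Arrow p\<^sub>1 p\<^sub>2 Pos, Arrow q\<^sub>1 p\<^sub>3 Pos, Arrow q\<^sub>2 q\<^sub>3 Pos}"
    "T' = {Arrow q\<^sub>1 q\<^sub>2 Pos, Arrow p\<^sub>1 q\<^sub>3 Pos, Arrow p\<^sub>2 p\<^sub>3 Pos}"
    using assms(1) by (rule triangleE)
  have T: "{p\<^sub>1, q\<^sub>1, p\<^sub>2, q\<^sub>2, p\<^sub>3, q\<^sub>3} = endpoints T"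
    using t(11) by auto
  show ?thesis
    unfolding triangle_def
    by (rule exI[of _ e\<^sub>1], rule exI[of _ e\<^sub>2], rule exI[of _ e\<^sub>3], rule exI[of _ p\<^sub>1], rule exI[of _ q\<^sub>1],
      rule exI[of _ p\<^sub>2], rule exI[of _ q\<^sub>2], rule exI[of _ p\<^sub>3], rule exI[of _ q\<^sub>3],
      intro conjI d t Y e) (use T in auto)
qed

text \<open>\<open>T'\<close> uses the same six endpoints as \<open>T\<close>, so it fits next to
  \<open>Z\<close> in the same way. The equality of sums matches each arrow of \<open>T\<close> with
  the arrow of \<open>T'\<close> joining the same two arcs.\<close>

lemma triangle_diagrams:
  assumes "triangle (Z \<union> T) T (Z \<union> T') T'" "Z \<inter> T = {}"
  shows "diagram_on_circle (Z \<union> T)" "diagram_on_circle (Z \<union> T')" "Z \<inter> T' = {}"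
    and "finite T" "finite T'"
    and "(\<Sum>a\<in>T. frag_of (gauss (insert a Z))) = (\<Sum>a\<in>T'. frag_of (gauss (insert a Z)))"
proof -
  obtain e\<^sub>1 e\<^sub>2 e\<^sub>3 p\<^sub>1 q\<^sub>1 p\<^sub>2 q\<^sub>2 p\<^sub>3 q\<^sub>3 where X: "diagram_on_circle (Z \<union> T)"
    and disj: "e\<^sub>1 \<inter> e\<^sub>2 = {}" "e\<^sub>1 \<inter> e\<^sub>3 = {}" "e\<^sub>2 \<inter> e\<^sub>3 = {}"
    and arcs: "consecutive_on_arc e\<^sub>1 p\<^sub>1 q\<^sub>1" "consecutive_on_arc e\<^sub>2 p\<^sub>2 q\<^sub>2"
      "consecutive_on_arc e\<^sub>3 p\<^sub>3 q\<^sub>3"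
    and ends: "e\<^sub>1 \<inter> endpoints (Z \<union> T) = {p\<^sub>1, q\<^sub>1}" "e\<^sub>2 \<inter> endpoints (Z \<union> T) = {p\<^sub>2, q\<^sub>2}"
      "e\<^sub>3 \<inter> endpoints (Z \<union> T) = {p\<^sub>3, q\<^sub>3}"
    and T: "T = {Arrow p\<^sub>1 p\<^sub>2 Pos, Arrow q\<^sub>1 p\<^sub>3 Pos, Arrow q\<^sub>2 q\<^sub>3 Pos}"
    and T': "T' = {Arrow q\<^sub>1 q\<^sub>2 Pos, Arrow p\<^sub>1 q\<^sub>3 Pos, Arrow p\<^sub>2 p\<^sub>3 Pos}"
    using assms(1) by (rule triangleE)
  show "diagram_on_circle (Z \<union> T)" "finite T" "finite T'"
    using X T T' by auto
  have Z: "diagram_on_circle T" "diagram_on_circle Z" "endpoints Z \<inter> endpoints T = {}"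
    using X assms(2) diagram_on_circle_Un by blast+
  obtain s1 u1 where arc1: "e\<^sub>1 = cis ` {s1..u1}" "p\<^sub>1 \<in> e\<^sub>1" "q\<^sub>1 \<in> e\<^sub>1" "p\<^sub>1 \<noteq> q\<^sub>1"
    using arcs(1) by (rule consecutive_on_arcE)
  obtain s2 u2 where arc2: "e\<^sub>2 = cis ` {s2..u2}" "p\<^sub>2 \<in> e\<^sub>2" "q\<^sub>2 \<in> e\<^sub>2" "p\<^sub>2 \<noteq> q\<^sub>2"
    using arcs(2) by (rule consecutive_on_arcE)
  obtain s3 u3 where arc3: "e\<^sub>3 = cis ` {s3..u3}" "p\<^sub>3 \<in> e\<^sub>3" "q\<^sub>3 \<in> e\<^sub>3" "p\<^sub>3 \<noteq> q\<^sub>3"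
    using arcs(3) by (rule consecutive_on_arcE)
  have neq: "p\<^sub>1 \<noteq> p\<^sub>2" "p\<^sub>1 \<noteq> q\<^sub>2" "p\<^sub>1 \<noteq> p\<^sub>3" "p\<^sub>1 \<noteq> q\<^sub>3" "q\<^sub>1 \<noteq> p\<^sub>2" "q\<^sub>1 \<noteq> q\<^sub>2" "q\<^sub>1 \<noteq> p\<^sub>3" "q\<^sub>1 \<noteq> q\<^sub>3"
      "p\<^sub>2 \<noteq> p\<^sub>3" "p\<^sub>2 \<noteq> q\<^sub>3" "q\<^sub>2 \<noteq> p\<^sub>3" "q\<^sub>2 \<noteq> q\<^sub>3"
    using disj arc1(2,3) arc2(2,3) arc3(2,3) by blast+
  note neqs = neq neq[symmetric] arc1(4) arc2(4) arc3(4)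
    arc1(4)[symmetric] arc2(4)[symmetric] arc3(4)[symmetric]
  have TT': "endpoints T' = endpoints T"
    using T T' by auto
  have "endpoints T' \<subseteq> circle"
    using Z(1) TT' by (simp add: diagram_on_circle_def)
  then have "diagram_on_circle T'"
    using neqs unfolding diagram_on_circle_def T' by (auto simp: arrow_ends_def)
  with Z TT' show "diagram_on_circle (Z \<union> T')" "Z \<inter> T' = {}"
    using diagram_on_circle_Un by metis+
  have eZ: "e\<^sub>1 \<inter> endpoints Z = {}" "e\<^sub>2 \<inter> endpoints Z = {}" "e\<^sub>3 \<inter> endpoints Z = {}"
    using ends Z(3) T by auto
  have ins: "diagram_on_circle (insert a Z)" if "a \<in> T" for a
    using that X diagram_on_circle_subset[of "Z \<union> T" "insert a Z"] by auto
  \<comment> \<open>Once the other two arrows are absent, each arc carries at most one endpoint,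
    which can slide between \<open>p\<close> and \<open>q\<close>.\<close>
  have "gauss (insert (Arrow q\<^sub>1 q\<^sub>2 Pos) Z) = gauss (insert (Arrow p\<^sub>1 p\<^sub>2 Pos) Z)"
    by (rule gauss_slide_arrow[OF ins arc1(1-3) arc2(1-3)]) (use T disj eZ in auto)
  moreover have "gauss (insert (Arrow p\<^sub>1 q\<^sub>3 Pos) Z) = gauss (insert (Arrow q\<^sub>1 p\<^sub>3 Pos) Z)"
    by (rule gauss_slide_arrow[OF ins arc1(1,3,2) arc3(1-3)]) (use T disj eZ in auto)
  moreover have "gauss (insert (Arrow p\<^sub>2 p\<^sub>3 Pos) Z) = gauss (insert (Arrow q\<^sub>2 q\<^sub>3 Pos) Z)"
    by (rule gauss_slide_arrow[OF ins arc2(1,3,2) arc3(1,3,2)]) (use T disj eZ in auto)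
  ultimately show "(\<Sum>a\<in>T. frag_of (gauss (insert a Z))) = (\<Sum>a\<in>T'. frag_of (gauss (insert a Z)))"
    unfolding T T' using neqs by simp
qed

text \<open>The moves require certain arcs to be free of other endpoints, and deleting bystander
  arrows preserves this. It lets one move act on all subdiagrams at once.\<close>

lemma local_move_subset:
  assumes "local_move Z T T'" "Y \<subseteq> Z"
  shows "local_move Y T T'"
  using assms
proof cases
  case (L1 a)
  then have "insert a Y \<subseteq> insert a Z"
    using assms(2) by blast
  then have "isolated_arrow (insert a Y) a"
    using L1 diagram_on_circle_subset adjacent_subset unfolding isolated_arrow_def by blast
  then show ?thesis
    using L1 assms(2) by (auto intro: local_move.L1)
next
  case (L2 a b)
  then have "Y \<union> {a, b} \<subseteq> Z \<union> {a, b}"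
    using assms(2) by blast
  then have "cancelling_arrows (Y \<union> {a, b}) a b"
    using L2 diagram_on_circle_subset adjacent_subset unfolding cancelling_arrows_def by blast
  then show ?thesis
    using L2 assms(2) by (auto intro!: local_move.L2)
next
  case L3
  then show ?thesis
    using triangle_subset assms(2) by (intro local_move.L3) auto
qed

lemma local_move_diagrams:
  assumes "local_move Z T T'"
  shows "diagram_on_circle (Z \<union> T)" "diagram_on_circle (Z \<union> T')" "Z \<inter> T = {}" "Z \<inter> T' = {}"
  using assms
  by (cases; auto simp: isolated_arrow_def cancelling_arrows_def triangle_diagrams
      intro: diagram_on_circle_subset)+

text \<open>Invariance of \<open>I_trunc\<close> uses the direction from moves to local moves; the
  factorization of a given invariant uses the converse.\<close>

lemma reidemeister_move_iff_local_move:
  "reidemeister_move D D' \<longleftrightarrow>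
     (\<exists>Z T T'. local_move Z T T' \<and> D = gauss (Z \<union> T) \<and> D' = gauss (Z \<union> T'))"
proof
  assume "reidemeister_move D D'"
  then show "\<exists>Z T T'. local_move Z T T' \<and> D = gauss (Z \<union> T) \<and> D' = gauss (Z \<union> T')"
  proof cases
    case (R1 X a)
    then have "X = (X - {a}) \<union> {a}"
      by (auto simp: isolated_arrow_def)
    then show ?thesis
      using R1 by (intro exI[of _ "X - {a}"] exI[of _ "{a}"] exI[of _ "{}"])
        (auto intro!: L1)
  next
    case (R2 X a b)
    then have "X = (X - {a, b}) \<union> {a, b}"
      by (auto simp: cancelling_arrows_def)
    then show ?thesis
      using R2 by (intro exI[of _ "X - {a, b}"] exI[of _ "{a, b}"] exI[of _ "{}"])
        (auto intro!: L2)
  next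
    case (R3 X T X' T')
    then have "X = (X - T) \<union> T" "X' = (X - T) \<union> T'"
      by (auto simp: triangle_def)
    then show ?thesis
      using R3 by (intro exI[of _ "X - T"] exI[of _ T] exI[of _ T']) (auto intro!: L3)
  qed
next
  assume "\<exists>Z T T'. local_move Z T T' \<and> D = gauss (Z \<union> T) \<and> D' = gauss (Z \<union> T')"
  then obtain Z T T' where m: "local_move Z T T'" and D: "D = gauss (Z \<union> T)" "D' = gauss (Z \<union> T')"
    by blast
  from m show "reidemeister_move D D'"
  proof cases
    case (L1 a)
    then show ?thesis
      using R1[of "insert a Z" a] D by simp
  next
    case (L2 a b)
    then have "Z \<union> {a, b} - {a, b} = Z"
      by blast
    then show ?thesis
      using L2 R2[of "Z \<union> {a, b}" a b] D by simp
  next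
    case L3
    then show ?thesis
      using R3 D by blast
  qed
qed

lemma isolated_arrow_relator:
  "a \<notin> Z \<Longrightarrow> frag_of (gauss (insert a Z)) = subset_sum Z {a} - subset_sum Z {}"
  by (simp add: subset_sum_insert)

text \<open>The three terms are the nonempty subsets of \<open>{a, b}\<close> added to
  \<open>Z\<close>; the difference removes the empty one.\<close>

lemma cancelling_arrows_relator:
  assumes "Z \<inter> {a, b} = {}" "a \<noteq> b"
  shows "frag_of (gauss (Z \<union> {a, b})) + frag_of (gauss (Z \<union> {a, b} - {b})) +
      frag_of (gauss (Z \<union> {a, b} - {a})) = subset_sum Z {a, b} - subset_sum Z {}"
proof -
  have "Z \<union> {a, b} - {b} = insert a Z" "Z \<union> {a, b} - {a} = insert b Z"
    using assms by auto
  then show ?thesis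
    using assms by (simp add: subset_sum_insert insert_commute)
qed

lemma triangle_relator:
  assumes "triangle (Z \<union> T) T (Z \<union> T') T'" "Z \<inter> T = {}"
  shows "triangle_sum (Z \<union> T) T - triangle_sum (Z \<union> T') T' = subset_sum Z T - subset_sum Z T'"
  using triangle_diagrams[OF assms] assms(2) by (simp add: subset_sum_triangle_sum)

text \<open>With \<open>reidemeister_move_iff_local_move\<close>, this puts moves and relators in
  correspondence, so that both halves of the theorem argue with the same triples \<open>Z\<close>,
  \<open>T\<close>, \<open>T'\<close>.\<close>

lemma polyak_relators_iff_local_move:
  "x \<in> polyak_relators \<longleftrightarrow> (\<exists>Z T T'. local_move Z T T' \<and> x = subset_sum Z T - subset_sum Z T')"
proof
  assume "x \<in> polyak_relators"
  then show "\<exists>Z T T'. local_move Z T T' \<and> x = subset_sum Z T - subset_sum Z T'"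
  proof cases
    case (P1 X a)
    then have X: "X = insert a (X - {a})"
      by (auto simp: isolated_arrow_def)
    then have "x = subset_sum (X - {a}) {a} - subset_sum (X - {a}) {}"
      using P1 isolated_arrow_relator[of a "X - {a}"] by simp
    moreover have "local_move (X - {a}) {a} {}"
      using P1 X by (intro L1) auto
    ultimately show ?thesis by blast
  next
    case (P2 X a b)
    then have X: "X = (X - {a, b}) \<union> {a, b}" and "a \<noteq> b"
      by (auto simp: cancelling_arrows_def)
    then have "x = subset_sum (X - {a, b}) {a, b} - subset_sum (X - {a, b}) {}"
      using P2 cancelling_arrows_relator[of "X - {a, b}" a b] by (metis Diff_disjoint inf_commute)
    moreover have "local_move (X - {a, b}) {a, b} {}"
      using P2 X by (intro L2) auto
    ultimately show ?thesis by blast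
  next
    case (P3 X T X' T')
    then have X: "X = (X - T) \<union> T" "X' = (X - T) \<union> T'"
      by (auto simp: triangle_def)
    then have t: "triangle ((X - T) \<union> T) T ((X - T) \<union> T') T'"
      using P3 by simp
    then have "x = subset_sum (X - T) T - subset_sum (X - T) T'"
      using P3 X triangle_relator[OF t] by (metis Diff_disjoint inf_commute)
    moreover have "local_move (X - T) T T'"
      using t by (intro L3) auto
    ultimately show ?thesis by blast
  qed
next
  assume "\<exists>Z T T'. local_move Z T T' \<and> x = subset_sum Z T - subset_sum Z T'"
  then obtain Z T T' where "local_move Z T T'" and x: "x = subset_sum Z T - subset_sum Z T'"
    by blast
  then show "x \<in> polyak_relators"
  proof cases
    case (L1 a)
    then show ?thesis
      using polyak_relators.P1 isolated_arrow_relator x by metis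
  next
    case (L2 a b)
    then have "a \<noteq> b"
      by (simp add: cancelling_arrows_def)
    then show ?thesis
      using L2 polyak_relators.P2 cancelling_arrows_relator x by metis
  next
    case L3
    then show ?thesis
      using polyak_relators.P3 triangle_relator x by metis
  qed
qed

section \<open>The truncated Polyak algebra as a quotient\<close>

lemma hom_frag_of_ext:
  assumes "group G" "f \<in> hom (free_Abelian_group UNIV) G" "g \<in> hom (free_Abelian_group UNIV) G"
    and "\<And>x. f (frag_of x) = g (frag_of x)"
  shows "f c = g c"
proof (rule free_Abelian_group_induct[of c UNIV])
  interpret f: group_hom "free_Abelian_group UNIV" G f
    using assms by (simp add: group_hom_def group_hom_axioms_def)
  interpret g: group_hom "free_Abelian_group UNIV" G g
    using assms by (simp add: group_hom_def group_hom_axioms_def)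
  show "f 0 = g 0"
    using f.hom_one g.hom_one by simp
  show "f (x - y) = g (x - y)" if "f x = g x" "f y = g y" for x y
    using that f.hom_mult[of x "- y"] g.hom_mult[of x "- y"] f.hom_inv[of y] g.hom_inv[of y]
    by simp
qed (use assms in auto)

lemma hom_sum_eq_one:
  assumes "group G" "f \<in> hom (free_Abelian_group UNIV) G" "\<And>i. i \<in> A \<Longrightarrow> f (x i) = \<one>\<^bsub>G\<^esub>"
  shows "f (sum x A) = \<one>\<^bsub>G\<^esub>"
proof -
  interpret group_hom "free_Abelian_group UNIV" G f
    using assms by (simp add: group_hom_def group_hom_axioms_def)
  show ?thesis
    using assms(3)
  proof (induction A rule: infinite_finite_induct)
    case (insert i A)
    then show ?case
      using hom_mult[of "x i" "sum x A"] by simp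
  qed (use hom_one in auto)
qed

lemma hom_diff_eq_one_iff:
  assumes "group G" "f \<in> hom (free_Abelian_group UNIV) G"
  shows "f (x - y) = \<one>\<^bsub>G\<^esub> \<longleftrightarrow> f x = f y"
proof -
  interpret group_hom "free_Abelian_group UNIV" G f
    using assms by (simp add: group_hom_def group_hom_axioms_def)
  have "f (x - y) = f x \<otimes>\<^bsub>G\<^esub> inv\<^bsub>G\<^esub> (f y)"
    using hom_mult[of x "- y"] hom_inv[of y] by simp
  moreover have "f x \<in> carrier G" "f y \<in> carrier G"
    by simp_all
  ultimately show ?thesis
    by (metis H.inv_equality H.inv_inv H.inv_closed H.r_inv)
qed

lemma frag_extend_in_hom:
  "frag_extend f \<in> hom (free_Abelian_group UNIV) (free_Abelian_group UNIV)"
  by (rule homI) (auto simp: frag_extend_add)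

context comm_group
begin

text \<open>Additional indices have exponent 0. The extensions at \<open>c\<close>, \<open>d\<close>
  and \<open>c + d\<close> can thus be written as products over one index set.\<close>

lemma linear_extension_superset:
  assumes "\<And>x. \<nu> x \<in> carrier G" "finite A" "Poly_Mapping.keys c \<subseteq> A"
  shows "linear_extension G \<nu> c = finprod G (\<lambda>x. \<nu> x [^] Poly_Mapping.lookup c x) A"
  unfolding linear_extension_def using assms
  by (intro finprod_mono_neutral_cong_left) (auto simp: in_keys_iff)

lemma linear_extension_in_hom:
  fixes \<nu> :: "'c \<Rightarrow> 'a"
  assumes "\<And>x. \<nu> x \<in> carrier G"
  shows "linear_extension G \<nu> \<in> hom (free_Abelian_group UNIV) G"
proof (rule homI)
  fix c d :: "'c \<Rightarrow>\<^sub>0 int"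
  show "linear_extension G \<nu> c \<in> carrier G"
    unfolding linear_extension_def using assms by (intro finprod_closed) auto
  let ?A = "Poly_Mapping.keys c \<union> Poly_Mapping.keys d"
  have "linear_extension G \<nu> (c + d) = finprod G (\<lambda>x. \<nu> x [^] Poly_Mapping.lookup (c + d) x) ?A"
    using assms keys_add[of c d] by (intro linear_extension_superset) auto
  also have "\<dots> = linear_extension G \<nu> c \<otimes> linear_extension G \<nu> d"
    using assms
    by (simp add: linear_extension_superset[of \<nu> ?A] lookup_add int_pow_mult Pi_def
        flip: finprod_multf)
  finally show "linear_extension G \<nu> (c \<otimes>\<^bsub>free_Abelian_group UNIV\<^esub> d) =
      linear_extension G \<nu> c \<otimes> linear_extension G \<nu> d"
    by simp
qed

lemma linear_extension_frag_of:
  assumes "\<And>x. \<nu> x \<in> carrier G"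
  shows "linear_extension G \<nu> (frag_of x) = \<nu> x"
  using assms by (simp add: linear_extension_def int_pow_1)

end

section \<open>The two successive quotients and their universal property\<close>

lemma subgroup_polyak_kernel: "subgroup polyak_kernel arrow_diagram_group"
  unfolding polyak_kernel_def by (rule group.generate_is_subgroup) auto

lemma normal_polyak_kernel: "polyak_kernel \<lhd> arrow_diagram_group"
  by (intro comm_group.subgroup_imp_normal abelian_free_Abelian_group subgroup_polyak_kernel)

lemma comm_group_polyak: "comm_group polyak"
  unfolding polyak_def
  by (intro comm_group.abelian_FactGroup abelian_free_Abelian_group subgroup_polyak_kernel)

lemma polyak_class_in_hom: "polyak_class \<in> hom arrow_diagram_group polyak"
  using normal.r_coset_hom_Mod[OF normal_polyak_kernel] unfolding polyak_def polyak_class_def .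

lemma polyak_class_closed: "polyak_class x \<in> carrier polyak"
  using polyak_class_in_hom by (rule hom_in_carrier) simp

lemma group_polyak: "group polyak"
  using comm_group_polyak by (rule comm_group.axioms)

lemma truncation_relators_closed:
  "{polyak_class (frag_of D) |D. num_arrows D > n} \<subseteq> carrier polyak"
  using polyak_class_closed by blast

lemma subgroup_truncation_kernel: "subgroup (truncation_kernel n) polyak"
  unfolding truncation_kernel_def
  by (rule group.generate_is_subgroup[OF group_polyak truncation_relators_closed])

lemma normal_truncation_kernel: "truncation_kernel n \<lhd> polyak"
  by (intro comm_group.subgroup_imp_normal comm_group_polyak subgroup_truncation_kernel)

lemma comm_group_polyak_trunc: "comm_group (polyak_trunc n)"
  unfolding polyak_trunc_def
  by (intro comm_group.abelian_FactGroup comm_group_polyak subgroup_truncation_kernel)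

lemma group_polyak_trunc: "group (polyak_trunc n)"
  using comm_group_polyak_trunc by (rule comm_group.axioms)

lemma polyak_trunc_class_in_hom:
  "polyak_trunc_class n \<in> hom arrow_diagram_group (polyak_trunc n)"
  using hom_compose[OF polyak_class_in_hom normal.r_coset_hom_Mod[OF normal_truncation_kernel]]
  unfolding polyak_trunc_def polyak_trunc_class_def comp_def .

lemma polyak_trunc_class_relator:
  assumes "x \<in> polyak_relators"
  shows "polyak_trunc_class n x = \<one>\<^bsub>polyak_trunc n\<^esub>"
proof -
  have "x \<in> polyak_kernel"
    unfolding polyak_kernel_def using assms by (rule generate.incl)
  then have "polyak_class x = \<one>\<^bsub>polyak\<^esub>"
    unfolding polyak_class_def polyak_def
    by (simp add: group.coset_join2 subgroup_polyak_kernel)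
  then show ?thesis
    unfolding polyak_trunc_class_def polyak_trunc_def
    by (simp add: group.coset_join2 group_polyak subgroup_truncation_kernel
        group.is_monoid subgroup.one_closed)
qed

lemma polyak_trunc_class_many_arrows:
  assumes "num_arrows D > n"
  shows "polyak_trunc_class n (frag_of D) = \<one>\<^bsub>polyak_trunc n\<^esub>"
proof -
  have "polyak_class (frag_of D) \<in> truncation_kernel n"
    unfolding truncation_kernel_def using assms by (intro generate.incl) blast
  then show ?thesis
    unfolding polyak_trunc_class_def polyak_trunc_def
    by (simp add: group.coset_join2 group_polyak subgroup_truncation_kernel polyak_class_closed)
qed

lemma FactGroup_generate_universal:
  assumes "group G" "group H" "\<phi> \<in> hom G H" "generate G R \<lhd> G" "R \<subseteq> carrier G"
    and "\<And>r. r \<in> R \<Longrightarrow> \<phi> r = \<one>\<^bsub>H\<^esub>"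
  obtains \<pi> where "\<pi> \<in> hom (G Mod generate G R) H"
    "\<And>x. x \<in> carrier G \<Longrightarrow> \<pi> (generate G R #>\<^bsub>G\<^esub> x) = \<phi> x"
proof -
  interpret group_hom G H \<phi>
    using assms by (simp add: group_hom_def group_hom_axioms_def)
  have "R \<subseteq> kernel G H \<phi>"
    using assms by (auto simp: kernel_def)
  then have "generate G R \<subseteq> kernel G H \<phi>"
    by (rule G.generate_subgroup_incl[OF _ subgroup_kernel])
  then show ?thesis
    using FactGroup_universal_kernel[OF assms(4)] that by metis
qed

text \<open>\<open>polyak_trunc\<close> is a quotient of a quotient, so \<open>\<phi>\<close> is
  factored twice: through \<open>polyak\<close> by \<open>rel\<close>, then the induced
  \<open>\<rho>\<close> through the truncation by \<open>many\<close>.\<close>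

lemma polyak_trunc_universal:
  assumes "group G" "\<phi> \<in> hom arrow_diagram_group G"
    and rel: "\<And>x. x \<in> polyak_relators \<Longrightarrow> \<phi> x = \<one>\<^bsub>G\<^esub>"
    and many: "\<And>D. num_arrows D > n \<Longrightarrow> \<phi> (frag_of D) = \<one>\<^bsub>G\<^esub>"
  obtains \<pi> where "\<pi> \<in> hom (polyak_trunc n) G" "\<And>x. \<pi> (polyak_trunc_class n x) = \<phi> x"
proof -
  obtain \<rho> where \<rho>: "\<rho> \<in> hom polyak G" "\<And>x. \<rho> (polyak_class x) = \<phi> x"
  proof (rule FactGroup_generate_universal[OF group_free_Abelian_group assms(1,2) _ _ rel])
    show "generate arrow_diagram_group polyak_relators \<lhd> arrow_diagram_group"
      using normal_polyak_kernel by (simp add: polyak_kernel_def)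
  qed (auto simp: polyak_def polyak_class_def polyak_kernel_def)
  have "\<rho> r = \<one>\<^bsub>G\<^esub>" if "r \<in> {polyak_class (frag_of D) |D. num_arrows D > n}" for r
    using that \<rho>(2) many by auto
  from FactGroup_generate_universal[OF group_polyak assms(1) \<rho>(1)
      normal_truncation_kernel[unfolded truncation_kernel_def] truncation_relators_closed this]
  obtain \<pi> where "\<pi> \<in> hom (polyak_trunc n) G"
    "\<And>x. x \<in> carrier polyak \<Longrightarrow> \<pi> (truncation_kernel n #>\<^bsub>polyak\<^esub> x) = \<rho> x"
    unfolding polyak_trunc_def truncation_kernel_def by blast
  then show ?thesis
    using that \<rho>(2) polyak_class_closed unfolding polyak_trunc_class_def by metis
qed

section \<open>Invariance\<close>

text \<open>Each subset of \<open>Z \<union> T\<close> is uniquely a subset of \<open>Z\<close>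
  together with a subset of \<open>T\<close>. For empty \<open>W\<close> this expands
  \<open>I\<close> of a diagram along the arrows not touched by a move.\<close>

lemma subset_sum_Un:
  assumes "finite Z" "finite T" "Z \<inter> T = {}"
  shows "subset_sum W (Z \<union> T) = (\<Sum>Y\<in>Pow Z. subset_sum (W \<union> Y) T)"
  using assms
proof (induction Z arbitrary: W rule: finite_induct)
  case (insert a Z)
  then show ?case
    using subset_sum_insert[of "Z \<union> T" a W] by (simp add: sum_Pow_insert)
qed simp

lemma I_map_gauss:
  assumes "diagram_on_circle X"
  shows "I_map (frag_of (gauss X)) = subset_sum {} X"
  using subdiagram_sum.abs_eq[OF diagram_equiv_refl[OF assms]]
  by (simp add: I_map_def subset_sum_def)

lemma polyak_trunc_class_I_map_move:
  assumes "reidemeister_move D D'"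
  shows "polyak_trunc_class n (I_map (frag_of D)) = polyak_trunc_class n (I_map (frag_of D'))"
proof -
  obtain Z T T' where m: "local_move Z T T'" and D: "D = gauss (Z \<union> T)" "D' = gauss (Z \<union> T')"
    using assms reidemeister_move_iff_local_move by blast
  note d = local_move_diagrams[OF m]
  then have "finite Z" "finite T" "finite T'"
    by (auto simp: diagram_on_circle_def)
  then have "I_map (frag_of D) - I_map (frag_of D') =
      (\<Sum>Y\<in>Pow Z. subset_sum Y T - subset_sum Y T')"
    using d by (simp add: D I_map_gauss subset_sum_Un sum_subtractf)
  moreover have "polyak_trunc_class n (subset_sum Y T - subset_sum Y T') = \<one>\<^bsub>polyak_trunc n\<^esub>"
    if "Y \<in> Pow Z" for Y
    using local_move_subset[OF m] that polyak_relators_iff_local_move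
    by (intro polyak_trunc_class_relator) blast
  then have "polyak_trunc_class n (\<Sum>Y\<in>Pow Z. subset_sum Y T - subset_sum Y T') =
      \<one>\<^bsub>polyak_trunc n\<^esub>"
    by (rule hom_sum_eq_one[OF group_polyak_trunc polyak_trunc_class_in_hom])
  ultimately have "polyak_trunc_class n (I_map (frag_of D) - I_map (frag_of D')) =
      \<one>\<^bsub>polyak_trunc n\<^esub>"
    by simp
  then show ?thesis
    using hom_diff_eq_one_iff[OF group_polyak_trunc polyak_trunc_class_in_hom] by blast
qed

lemma knot_eq_iff: "knot D = knot D' \<longleftrightarrow> equivclp reidemeister_move D D'"
  by (rule virtual_knot.abs_eq_iff)

text \<open>Constancy along single moves passes to the generated equivalence, so the definite
  description in \<open>I_trunc\<close> has exactly one value.\<close>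

lemma I_trunc_knot: "I_trunc n (knot D) = polyak_trunc_class n (I_map (frag_of D))"
proof -
  have "polyak_trunc_class n (I_map (frag_of D)) = polyak_trunc_class n (I_map (frag_of D'))"
    if "equivclp reidemeister_move D D'" for D'
    using that
    by (induction rule: equivclp_induct) (auto dest: polyak_trunc_class_I_map_move[of _ _ n])
  then show ?thesis
    unfolding I_trunc_def
    by (intro the_equality) (metis knot_eq_iff)+
qed

section \<open>Semi-virtual crossings\<close>

lemma semi_virtual_empty [simp]: "semi_virtual X {} = frag_of (gauss X)"
  by (simp add: semi_virtual_def)

text \<open>A semi-virtual crossing is the real one minus the virtual one: the subsets containing
  \<open>a\<close> acquire one more sign.\<close>

lemma semi_virtual_insert:
  assumes "finite C" "a \<notin> C"
  shows "semi_virtual X (insert a C) = semi_virtual X C - semi_virtual (X - {a}) C"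
proof -
  have "(\<Sum>S\<in>Pow C. frag_cmul ((-1) ^ card (insert a S)) (frag_of (gauss (X - insert a S)))) =
      (\<Sum>S\<in>Pow C. - frag_cmul ((-1) ^ card S) (frag_of (gauss (X - {a} - S))))"
  proof (rule sum.cong[OF refl])
    fix S assume "S \<in> Pow C"
    then have "finite S" "a \<notin> S" "X - insert a S = X - {a} - S"
      using assms finite_subset by auto
    then show "frag_cmul ((-1) ^ card (insert a S)) (frag_of (gauss (X - insert a S))) =
        - frag_cmul ((-1) ^ card S) (frag_of (gauss (X - {a} - S)))"
      by simp
  qed
  also have "\<dots> = - semi_virtual (X - {a}) C"
    by (simp add: semi_virtual_def sum_negf del: minus_frag_cmul)
  finally show ?thesis
    using assms by (simp add: semi_virtual_def sum_Pow_insert)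
qed

text \<open>Inclusion-exclusion, one arrow of \<open>C\<close> at a time: among the subdiagrams
  containing \<open>C\<close>, those avoiding \<open>a\<close> are exactly the ones
  subtracted.\<close>

lemma I_map_semi_virtual:
  assumes "diagram_on_circle X" "C \<subseteq> X"
  shows "I_map (semi_virtual X C) = (\<Sum>Y\<in>Pow (X - C). frag_of (gauss (Y \<union> C)))"
proof -
  have "finite C"
    using assms finite_subset by (auto simp: diagram_on_circle_def)
  then show ?thesis
    using assms
  proof (induction C arbitrary: X rule: finite_induct)
    case empty
    then show ?case
      by (simp add: I_map_gauss subset_sum_def)
  next
    case (insert a C)
    define R where "R = X - insert a C"
    have diag: "diagram_on_circle (X - {a})" and C: "C \<subseteq> X - {a}"
      using insert.prems insert.hyps diagram_on_circle_subset[of X "X - {a}"] by auto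
    have R: "X - C = insert a R" "X - {a} - C = R" "a \<notin> R" "finite R"
      using insert.prems insert.hyps by (auto simp: R_def diagram_on_circle_def)
    have "I_map (semi_virtual X (insert a C)) =
        I_map (semi_virtual X C) - I_map (semi_virtual (X - {a}) C)"
      using insert.hyps by (simp add: semi_virtual_insert I_map_def frag_extend_diff)
    also have "I_map (semi_virtual X C) = (\<Sum>Y\<in>Pow (insert a R). frag_of (gauss (Y \<union> C)))"
      using insert.IH[of X] insert.prems R(1) by simp
    also have "\<dots> = (\<Sum>Y\<in>Pow R. frag_of (gauss (Y \<union> C))) +
        (\<Sum>Y\<in>Pow R. frag_of (gauss (insert a Y \<union> C)))"
      by (rule sum_Pow_insert[OF R(4,3)])
    also have "I_map (semi_virtual (X - {a}) C) = (\<Sum>Y\<in>Pow R. frag_of (gauss (Y \<union> C)))"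
      using insert.IH[OF diag C] R(2) by simp
    finally show ?case
      by (simp add: R_def)
  qed
qed

text \<open>The inverse of \<open>I\<close>, by Moebius inversion on the subsets of arrows.\<close>

lift_definition alternating_sum :: "gauss_diagram \<Rightarrow> (gauss_diagram \<Rightarrow>\<^sub>0 int)" is
  "\<lambda>X. semi_virtual X X"
proof -
  fix X X' assume eq: "diagram_equiv X X'"
  then obtain h where h: "orientation_preserving_homeo h" "X' = map_arrow h ` X"
    and X: "diagram_on_circle X"
    by (auto simp: diagram_equiv_def)
  have inj: "inj_on (map_arrow h) X"
    using map_arrow_inj_on[OF X h(1)] .
  have "Pow X' = image (map_arrow h) ` Pow X"
    using h(2) by (simp add: image_Pow_surj)
  then have "semi_virtual X' X' = (\<Sum>S\<in>Pow X. frag_cmul ((-1) ^ card (map_arrow h ` S))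
      (frag_of (gauss (X' - map_arrow h ` S))))"
    using inj_on_image_Pow[OF inj] by (simp add: semi_virtual_def sum.reindex)
  also have "\<dots> = semi_virtual X X"
    unfolding semi_virtual_def
  proof (rule sum.cong[OF refl])
    fix S assume S: "S \<in> Pow X"
    then have "card (map_arrow h ` S) = card S"
      using inj by (metis PowD card_image inj_on_subset)
    moreover have "X' - map_arrow h ` S = map_arrow h ` (X - S)"
      using inj_on_image_set_diff[OF inj, of X S] S h(2) by auto
    moreover have "gauss (map_arrow h ` (X - S)) = gauss (X - S)"
      using diagram_on_circle_subset[OF X] h(1) by (intro gauss_image) auto
    ultimately show "frag_cmul ((-1) ^ card (map_arrow h ` S))
        (frag_of (gauss (X' - map_arrow h ` S))) = frag_cmul ((-1) ^ card S) (frag_of (gauss (X - S)))"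
      by simp
  qed
  finally show "semi_virtual X X = semi_virtual X' X'"
    by simp
qed

text \<open>Adding \<open>a\<close> to \<open>T\<close> contributes a diagram in which
  \<open>a\<close> is semi-virtual as well; its part without \<open>a\<close> cancels the sum for
  the smaller \<open>T\<close>. The case \<open>Z = {}\<close> says that
  \<open>alternating_sum\<close> inverts \<open>I\<close>.\<close>

lemma frag_extend_alternating_sum_subset_sum:
  assumes "diagram_on_circle (Z \<union> T)" "Z \<inter> T = {}"
  shows "frag_extend alternating_sum (subset_sum Z T) = semi_virtual (Z \<union> T) Z"
proof -
  have "finite T" "finite Z"
    using assms by (auto simp: diagram_on_circle_def)
  then show ?thesis
    using assms
  proof (induction T arbitrary: Z rule: finite_induct)
    case empty
    then show ?case
      using alternating_sum.abs_eq[OF diagram_equiv_refl] by simp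
  next
    case (insert a T)
    have "diagram_on_circle (Z \<union> T)"
      using insert.prems diagram_on_circle_subset[of "Z \<union> insert a T" "Z \<union> T"] by auto
    moreover have "insert a (Z \<union> T) - {a} = Z \<union> T"
      using insert.prems insert.hyps by auto
    ultimately show ?case
      using insert.prems insert.hyps insert.IH[of Z] insert.IH[of "insert a Z"]
      by (simp add: subset_sum_insert frag_extend_add semi_virtual_insert)
  qed
qed

text \<open>The semi-virtual arrows lie outside the move, so it can be performed in every summand
  and the knots agree term by term.\<close>

lemma knot_classes_semi_virtual_move:
  assumes "local_move Z T T'"
  shows "knot_classes (semi_virtual (Z \<union> T) Z) = knot_classes (semi_virtual (Z \<union> T') Z)"
proof -
  note d = local_move_diagrams[OF assms]
  then have fin: "finite Z"
    by (auto simp: diagram_on_circle_def)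
  have "knot (gauss (Z \<union> T - S)) = knot (gauss (Z \<union> T' - S))" if "S \<in> Pow Z" for S
  proof -
    have "Z \<union> T - S = (Z - S) \<union> T" "Z \<union> T' - S = (Z - S) \<union> T'"
      using that d by auto
    moreover have "local_move (Z - S) T T'"
      using local_move_subset[OF assms] by blast
    ultimately have "reidemeister_move (gauss (Z \<union> T - S)) (gauss (Z \<union> T' - S))"
      using reidemeister_move_iff_local_move by metis
    then show ?thesis
      unfolding knot_eq_iff by (rule r_into_equivclp)
  qed
  then show ?thesis
    using fin by (simp add: knot_classes_def semi_virtual_def frag_extend_sum frag_extend_cmul)
qed

theorem theorem2p5:
  fixes n :: nat
  shows "comm_group (polyak_trunc n) \<and>
    (\<forall>D. I_trunc n (knot D) = polyak_trunc_class n (I_map (frag_of D))) \<and>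
    invariant_of_degree_at_most (polyak_trunc n) n (I_trunc n) \<and>
    (\<forall>(G :: ('g, 'm) monoid_scheme) \<nu>.
       comm_group G \<and> invariant_of_degree_at_most G n \<nu> \<longrightarrow>
       (\<exists>\<pi> \<in> hom (polyak_trunc n) G. \<forall>K. \<nu> K = \<pi> (I_trunc n K)))"
proof (intro conjI allI impI)
  show "comm_group (polyak_trunc n)"
    by (rule comm_group_polyak_trunc)
  then interpret P: comm_group "polyak_trunc n" .
  show "I_trunc n (knot D) = polyak_trunc_class n (I_map (frag_of D))" for D
    by (rule I_trunc_knot)
  have knot_surj: "\<exists>D. K = knot D" for K
    by (metis Quotient3_abs_rep[OF Quotient3_virtual_knot])
  have closed: "I_trunc n K \<in> carrier (polyak_trunc n)" for K
    using knot_surj[of K] hom_in_carrier[OF polyak_trunc_class_in_hom] I_trunc_knot by auto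
  have knot_hom: "knot_classes \<in> hom (free_Abelian_group UNIV) (free_Abelian_group UNIV)"
    unfolding knot_classes_def by (rule frag_extend_in_hom)
  show "invariant_of_degree_at_most (polyak_trunc n) n (I_trunc n)"
    unfolding invariant_of_degree_at_most_def
  proof (intro conjI allI impI closed)
    fix X C assume XC: "diagram_on_circle X \<and> C \<subseteq> X \<and> n < card C"
    \<comment> \<open>Both sides are homomorphisms and agree on single Gauss diagrams by
      \<open>I_trunc_knot\<close>; the degree bound is then a statement about
      \<open>I_map\<close>.\<close>
    have "linear_extension (polyak_trunc n) (I_trunc n) (knot_classes c) =
        polyak_trunc_class n (I_map c)" for c
    proof -
      have "(linear_extension (polyak_trunc n) (I_trunc n) \<circ> knot_classes) c =
          (polyak_trunc_class n \<circ> I_map) c"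
      proof (rule hom_frag_of_ext[OF group_polyak_trunc])
        show "linear_extension (polyak_trunc n) (I_trunc n) \<circ> knot_classes
            \<in> hom (free_Abelian_group UNIV) (polyak_trunc n)"
          using Group.hom_compose[OF knot_hom P.linear_extension_in_hom] closed by blast
        show "polyak_trunc_class n \<circ> I_map \<in> hom (free_Abelian_group UNIV) (polyak_trunc n)"
          unfolding I_map_def by (rule Group.hom_compose[OF frag_extend_in_hom polyak_trunc_class_in_hom])
        show "(linear_extension (polyak_trunc n) (I_trunc n) \<circ> knot_classes) (frag_of D) =
            (polyak_trunc_class n \<circ> I_map) (frag_of D)" for D
          using closed
          by (simp add: knot_classes_def P.linear_extension_frag_of I_trunc_knot)
      qed
      then show ?thesis by simp
    qed
    moreover have "polyak_trunc_class n (frag_of (gauss (Y \<union> C))) = \<one>\<^bsub>polyak_trunc n\<^esub>"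
      if "Y \<in> Pow (X - C)" for Y
    proof (rule polyak_trunc_class_many_arrows)
      have "diagram_on_circle (Y \<union> C)"
        using that XC diagram_on_circle_subset[of X "Y \<union> C"] by blast
      then have "num_arrows (gauss (Y \<union> C)) = card (Y \<union> C)" "finite (Y \<union> C)"
        using num_arrows.abs_eq diagram_equiv_refl by (auto simp: diagram_on_circle_def)
      then show "n < num_arrows (gauss (Y \<union> C))"
        using XC card_mono[of "Y \<union> C" C] by auto
    qed
    then have "polyak_trunc_class n (\<Sum>Y\<in>Pow (X - C). frag_of (gauss (Y \<union> C))) =
        \<one>\<^bsub>polyak_trunc n\<^esub>"
      by (rule hom_sum_eq_one[OF group_polyak_trunc polyak_trunc_class_in_hom])
    ultimately show "linear_extension (polyak_trunc n) (I_trunc n)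
        (knot_classes (semi_virtual X C)) = \<one>\<^bsub>polyak_trunc n\<^esub>"
      using XC by (simp add: I_map_semi_virtual)
  qed
  fix G :: "('g, 'm) monoid_scheme" and \<nu>
  assume G: "comm_group G \<and> invariant_of_degree_at_most G n \<nu>"
  then interpret comm_group G by blast
  have \<nu>: "\<nu> K \<in> carrier G" for K
    using G by (simp add: invariant_of_degree_at_most_def)
  \<comment> \<open>\<open>\<psi>\<close> is \<open>\<nu>\<close> extended linearly to Gauss
    diagrams. Composing it with the inverse of \<open>I\<close> gives \<open>\<phi>\<close>, whose
    value at \<open>I(D)\<close> is \<open>\<nu>\<close> of the knot of \<open>D\<close>.\<close>
  define \<psi> where "\<psi> = linear_extension G \<nu> \<circ> knot_classes"
  define \<phi> where "\<phi> = \<psi> \<circ> frag_extend alternating_sum"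
  have "\<psi> \<in> hom (free_Abelian_group UNIV) G"
    unfolding \<psi>_def using Group.hom_compose[OF knot_hom linear_extension_in_hom] \<nu> by blast
  then have \<phi>: "\<phi> \<in> hom arrow_diagram_group G"
    unfolding \<phi>_def by (rule Group.hom_compose[OF frag_extend_in_hom])
  have "\<phi> x = \<one>\<^bsub>G\<^esub>" if relator: "x \<in> polyak_relators" for x
  proof -
    obtain Z T T' where m: "local_move Z T T'" and x: "x = subset_sum Z T - subset_sum Z T'"
      using relator polyak_relators_iff_local_move by blast
    have "\<phi> (subset_sum Z T) = \<phi> (subset_sum Z T')"
      using local_move_diagrams[OF m] knot_classes_semi_virtual_move[OF m]
      by (simp add: \<phi>_def \<psi>_def frag_extend_alternating_sum_subset_sum)
    then show ?thesis
      using hom_diff_eq_one_iff[OF _ \<phi>] x is_group by blast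
  qed
  moreover have "\<phi> (frag_of D) = \<one>\<^bsub>G\<^esub>" if D: "num_arrows D > n" for D
  proof -
    obtain X where X: "diagram_on_circle X" "D = gauss X"
      by (rule gauss_surj)
    \<comment> \<open>All arrows of \<open>X\<close> are semi-virtual here, so the degree bound
      applies with \<open>C = X\<close>.\<close>
    then have "card X > n" "alternating_sum D = semi_virtual X X"
      using D num_arrows.abs_eq alternating_sum.abs_eq diagram_equiv_refl by auto
    then show ?thesis
      using G X by (simp add: \<phi>_def \<psi>_def invariant_of_degree_at_most_def)
  qed
  ultimately obtain \<pi> where \<pi>: "\<pi> \<in> hom (polyak_trunc n) G"
    "\<And>x. \<pi> (polyak_trunc_class n x) = \<phi> x"
    using polyak_trunc_universal[OF is_group \<phi>] by metis
  have "\<nu> (knot D) = \<pi> (I_trunc n (knot D))" for D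
  proof -
    obtain X where X: "diagram_on_circle X" "D = gauss X"
      by (rule gauss_surj)
    then show ?thesis
      using frag_extend_alternating_sum_subset_sum[of "{}" X] \<nu>
      by (simp add: I_trunc_knot \<pi>(2) I_map_gauss \<phi>_def \<psi>_def knot_classes_def
          linear_extension_frag_of)
  qed
  then show "\<exists>\<pi>\<in>hom (polyak_trunc n) G. \<forall>K. \<nu> K = \<pi> (I_trunc n K)"
    using \<pi>(1) knot_surj by metis
qed

end
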